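(* Let $f=f_0+f_1$ satisfy the standing assumptions (i)–(iv) of the context, and suppose that $f$ is a KL function. Let $\{x^{(k)}\}_{k\in\mathbb{N}}$, $\{\tilde y^{(k)}\}_{k\in\mathbb{N}}$ be sequences generated by Algorithm VMILAn (see context). Assume that there exist $b>0$, real numbers $\zeta_k\ge 0$ ($k\ge 1$) with $\sum_{k=1}^{\infty}\zeta_k<\infty$, and vectors $v^{(k)}\in\partial f(\tilde y^{(k)})$ such that for all $k\in\mathbb{N}$ $$\|v^{(k)}\|\le b\,\|x^{(k+1)}-x^{(k)}\|+\zeta_{k+1},$$ and assume that $\{x^{(k)}\}_{k\in\mathbb{N}}$ admits a limit point $\bar x$. Then $$\sum_{k=0}^{+\infty}\|x^{(k+1)}-x^{(k)}\|<+\infty$$ and, therefore, the whole sequence $\{x^{(k)}\}_{k\in\mathbb{N}}$ converges to $\bar x$, which is stationary for the problem $\min_{x\in\mathbb{R}^n}f(x)$.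
   Context: Notation. $\mathbb{N}=\{0,1,2,\dots\}$, $\bar{\mathbb{R}}=\mathbb{R}\cup\{\pm\infty\}$; $\|\cdot\|$ is the Euclidean norm on $\mathbb{R}^n$; for a symmetric positive definite matrix $D$, $\|x\|_D=\sqrt{x^TDx}$. For $\mu\ge1$, $\mathcal{M}_\mu$ is the set of symmetric positive definite $n\times n$ matrices with all eigenvalues in $[1/\mu,\mu]$. A limit point of a sequence is the limit of a subsequence. Standing assumptions. (i) $f_1:\mathbb{R}^n\to\bar{\mathbb{R}}$ is proper, convex and lower semicontinuous. (ii) $f_0:\mathbb{R}^n\to\mathbb{R}$ is continuously differentiable on an open set $\Omega_0\supset\mathrm{dom}(f_1)$. (iii) $\nabla f_0$ is $L$-Lipschitz continuous on $\mathrm{dom}(f_1)$ with $L>0$: $\|\nabla f_0(x)-\nabla f_0(y)\|\le L\|x-y\|$ for all $x,y\in\mathrm{dom}(f_1)$. (iv) $f=f_0+f_1$ is bounded from below. Subdifferentials. For $\Psi:\mathbb{R}^n\to\bar{\mathbb{R}}$ and $x\in\mathrm{dom}(\Psi)$, $\hat\partial\Psi(x)=\{v:\liminf_{y\to x,y\ne x}\frac{1}{\|x-y\|}(\Psi(y)-\Psi(x)-(y-x)^Tv)\ge0\}$ and $\partial\Psi(x)=\{v:\exists\, y^{(k)}\to x,\ \Psi(y^{(k)})\to\Psi(x),\ v^{(k)}\in\hat\partial\Psi(y^{(k)}),\ v^{(k)}\to v\}$. $\mathrm{dom}(\partial\Psi)=\{x\in\mathrm{dom}(\Psi):\partial\Psi(x)\neq\emptyset\}$.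 A point $x$ is stationary for $\Psi$ (equivalently for $\min\Psi$) if $x\in\mathrm{dom}(\Psi)$ and $0\in\partial\Psi(x)$. KL property. A proper lower semicontinuous $f:\mathbb{R}^n\to\bar{\mathbb{R}}$ has the KL property at $\bar z\in\mathrm{dom}(\partial f)$ if there exist $\upsilon\in(0,+\infty]$, a neighborhood $U$ of $\bar z$ and a continuous concave function $\phi:[0,\upsilon)\to[0,+\infty)$ such that $\phi(0)=0$, $\phi$ is $C^1$ on $(0,\upsilon)$, $\phi'(s)>0$ for all $s\in(0,\upsilon)$, and $\phi'(f(z)-f(\bar z))\,\mathrm{dist}(0,\partial f(z))\ge1$ for all $z\in U$ with $f(\bar z)<f(z)<f(\bar z)+\upsilon$, where $\mathrm{dist}(z,\Omega)=\inf_{x\in\Omega}\|x-z\|$. $f$ is a KL function if it has the KL property at every point of $\mathrm{dom}(\partial f)$. Algorithm VMILAn. Choose constants $0<\alpha_{\min}\le\alpha_{\max}$, $\mu\ge1$, $\delta,\beta\in(0,1)$, $\gamma\in[0,1]$, $\tau>0$ and $x^{(0)}\in\mathrm{dom}(f_1)$. For $k=0,1,2,\dots$: 1. Choose any $\alpha_k\in[\alpha_{\min},\alpha_{\max}]$ and $D_k\in\mathcal{M}_\mu$. 2. Let $h^{(k)}_\gamma(x)=\nabla f_0(x^{(k)})^T(x-x^{(k)})+\frac{\gamma}{2\alpha_k}\|x-x^{(k)}\|_{D_k}^2+f_1(x)-f_1(x^{(k)})$, let $h^{(k)}=h^{(k)}_1$ (i.e. with $\gamma=1$), and let $y^{(k)}=\arg\min_{x\in\mathbb{R}^n}h^{(k)}(x)$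 (unique). Compute any $\tilde y^{(k)}$ such that $h^{(k)}(\tilde y^{(k)})-h^{(k)}(y^{(k)})\le-\frac{\tau}{2}h^{(k)}_\gamma(\tilde y^{(k)})$. 3. Set $d^{(k)}=\tilde y^{(k)}-x^{(k)}$. 4. Let $i_k$ be the smallest non-negative integer such that $f(x^{(k)}+\delta^{i_k}d^{(k)})\le f(x^{(k)})+\beta\delta^{i_k}h^{(k)}_\gamma(\tilde y^{(k)})$ and set $\lambda_k=\delta^{i_k}$. 5. Set $x^{(k+1)}=\tilde y^{(k)}$ if $f(\tilde y^{(k)})<f(x^{(k)}+\lambda_kd^{(k)})$, and $x^{(k+1)}=x^{(k)}+\lambda_kd^{(k)}$ otherwise. *)

theory Defs
  imports "HOL-Analysis.Analysis"
begin

definition effdom :: "('a \<Rightarrow> ereal) \<Rightarrow> 'a set" where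
  "effdom f = {x. f x < \<infinity>}"

definition proper_fun :: "('a \<Rightarrow> ereal) \<Rightarrow> bool" where
  "proper_fun f \<longleftrightarrow> (\<forall>x. f x \<noteq> -\<infinity>) \<and> effdom f \<noteq> {}"

text \<open>Only used for proper functions, so the value of \<open>\<infinity> + (-\<infinity>)\<close> plays no role. At the end
  points of \<open>{0..1}\<close> the convention \<open>0 * \<infinity> = 0\<close> makes the inequality trivial.\<close>

definition convex_fun :: "('a::real_vector \<Rightarrow> ereal) \<Rightarrow> bool" where
  "convex_fun f \<longleftrightarrow>
     (\<forall>x y. \<forall>t\<in>{0..1}.
        f ((1 - t) *\<^sub>R x + t *\<^sub>R y) \<le> ereal (1 - t) * f x + ereal t * f y)"

definition lsc_fun :: "('a::topological_space \<Rightarrow> ereal) \<Rightarrow> bool" where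
  "lsc_fun f \<longleftrightarrow> (\<forall>x. f x \<le> Liminf (at x) f)"

text \<open>The value of \<open>grad f x\<close> is meaningful only where \<open>f\<close> is differentiable.\<close>

definition grad :: "('a::real_inner \<Rightarrow> real) \<Rightarrow> 'a \<Rightarrow> 'a" where
  "grad f x = (THE D. GDERIV f x :> D)"

definition C1_fun_on :: "'a::real_inner set \<Rightarrow> ('a \<Rightarrow> real) \<Rightarrow> bool" where
  "C1_fun_on S f \<longleftrightarrow> (\<forall>x\<in>S. f differentiable (at x)) \<and> continuous_on S (grad f)"

text \<open>Both subdifferentials are empty outside the effective domain. The filter \<open>at x\<close> is
  punctured, as the limes inferior in the definition requires.\<close>

definition frechet_subdiff :: "('a::real_inner \<Rightarrow> ereal) \<Rightarrow> 'a \<Rightarrow> 'a set" where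
  "frechet_subdiff \<Psi> x =
     {v. x \<in> effdom \<Psi> \<and>
         0 \<le> Liminf (at x)
               (\<lambda>y. ereal (1 / norm (x - y)) * (\<Psi> y - \<Psi> x - ereal ((y - x) \<bullet> v)))}"

definition subdiff :: "('a::real_inner \<Rightarrow> ereal) \<Rightarrow> 'a \<Rightarrow> 'a set" where
  "subdiff \<Psi> x =
     {v. x \<in> effdom \<Psi> \<and>
         (\<exists>y w. y \<longlonglongrightarrow> x \<and> (\<lambda>k. \<Psi> (y k)) \<longlonglongrightarrow> \<Psi> x \<and>
                (\<forall>k::nat. w k \<in> frechet_subdiff \<Psi> (y k)) \<and> w \<longlonglongrightarrow> v)}"

definition dom_subdiff :: "('a::real_inner \<Rightarrow> ereal) \<Rightarrow> 'a set" where
  "dom_subdiff \<Psi> = {x \<in> effdom \<Psi>. subdiff \<Psi> x \<noteq> {}}"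

definition stationary_point :: "('a::real_inner \<Rightarrow> ereal) \<Rightarrow> 'a \<Rightarrow> bool" where
  "stationary_point \<Psi> x \<longleftrightarrow> x \<in> effdom \<Psi> \<and> 0 \<in> subdiff \<Psi> x"

text \<open>Unlike \<open>infdist\<close>, which is \<open>0\<close> on the empty set, this distance is \<open>\<infinity>\<close> there; the
  Kurdyka--Lojasiewicz inequality thus holds trivially at points with empty subdifferential.\<close>

definition dist_to_set :: "'a::real_normed_vector \<Rightarrow> 'a set \<Rightarrow> ereal" where
  "dist_to_set z S = (INF x\<in>S. ereal (norm (x - z)))"

text \<open>In the inequality both \<open>f z\<close> and \<open>f zb\<close> are finite when \<open>f\<close> is proper, so
  \<open>real_of_ereal\<close> loses nothing.\<close>

definition KL_property_at :: "('a::real_inner \<Rightarrow> ereal) \<Rightarrow> 'a \<Rightarrow> bool" where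
  "KL_property_at f zb \<longleftrightarrow>
     zb \<in> dom_subdiff f \<and>
     (\<exists>(\<upsilon>::ereal) U (\<phi>::real \<Rightarrow> real) (\<phi>'::real \<Rightarrow> real).
        0 < \<upsilon> \<and> zb \<in> interior U \<and>
        continuous_on {s. 0 \<le> s \<and> ereal s < \<upsilon>} \<phi> \<and>
        concave_on {s. 0 \<le> s \<and> ereal s < \<upsilon>} \<phi> \<and>
        (\<forall>s. 0 \<le> s \<and> ereal s < \<upsilon> \<longrightarrow> 0 \<le> \<phi> s) \<and>
        \<phi> 0 = 0 \<and>
        (\<forall>s. 0 < s \<and> ereal s < \<upsilon> \<longrightarrow> (\<phi> has_real_derivative \<phi>' s) (at s)) \<and>
        continuous_on {s. 0 < s \<and> ereal s < \<upsilon>} \<phi>' \<and>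
        (\<forall>s. 0 < s \<and> ereal s < \<upsilon> \<longrightarrow> 0 < \<phi>' s) \<and>
        (\<forall>z\<in>U. f zb < f z \<and> f z < f zb + \<upsilon> \<longrightarrow>
           1 \<le> ereal (\<phi>' (real_of_ereal (f z - f zb))) * dist_to_set 0 (subdiff f z)))"

definition KL_function :: "('a::real_inner \<Rightarrow> ereal) \<Rightarrow> bool" where
  "KL_function f \<longleftrightarrow>
     proper_fun f \<and> lsc_fun f \<and> (\<forall>zb\<in>dom_subdiff f. KL_property_at f zb)"

definition scaling_matrices :: "real \<Rightarrow> (real ^ 'n ^ 'n) set" where
  "scaling_matrices \<mu> =
     {D. transpose D = D \<and> (\<forall>x. x \<noteq> 0 \<longrightarrow> 0 < x \<bullet> (D *v x)) \<and>
         (\<forall>l x. x \<noteq> 0 \<and> D *v x = l *\<^sub>R x \<longrightarrow> l \<in> {1 / \<mu> .. \<mu>})}"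

definition norm_mat :: "real ^ 'n ^ 'n \<Rightarrow> real ^ 'n \<Rightarrow> real" where
  "norm_mat D x = sqrt (x \<bullet> (D *v x))"

definition hmodel ::
  "(real ^ 'n \<Rightarrow> real) \<Rightarrow> (real ^ 'n \<Rightarrow> ereal) \<Rightarrow> real \<Rightarrow> real ^ 'n ^ 'n \<Rightarrow> real ^ 'n \<Rightarrow>
   real \<Rightarrow> real ^ 'n \<Rightarrow> ereal" where
  "hmodel f0 f1 \<alpha> D xk \<gamma> x =
     ereal (grad f0 xk \<bullet> (x - xk) + \<gamma> / (2 * \<alpha>) * (norm_mat D (x - xk))\<^sup>2) + f1 x - f1 xk"

text \<open>The minimal line-search exponent \<open>i\<close> is not written with \<open>LEAST\<close>, which would be
  unspecified if no exponent passed the test.\<close>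

definition VMILAn_step ::
  "(real ^ 'n \<Rightarrow> real) \<Rightarrow> (real ^ 'n \<Rightarrow> ereal) \<Rightarrow>
   real \<Rightarrow> real \<Rightarrow> real \<Rightarrow> real \<Rightarrow> real \<Rightarrow> real \<Rightarrow> real \<Rightarrow>
   real ^ 'n \<Rightarrow> real ^ 'n \<Rightarrow> real ^ 'n \<Rightarrow> bool" where
  "VMILAn_step f0 f1 \<alpha>min \<alpha>max \<mu> \<delta> \<beta> \<gamma> \<tau> xk yt xnext \<longleftrightarrow>
     (\<exists>\<alpha> D y (i::nat).
        let f = (\<lambda>x. ereal (f0 x) + f1 x);
            h = hmodel f0 f1 \<alpha> D xk;
            d = yt - xk;
            accept = (\<lambda>j. f (xk + \<delta> ^ j *\<^sub>R d) \<le> f xk + ereal (\<beta> * \<delta> ^ j) * h \<gamma> yt);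
            xl = xk + \<delta> ^ i *\<^sub>R d
        in \<alpha> \<in> {\<alpha>min..\<alpha>max} \<and> D \<in> scaling_matrices \<mu> \<and>
           is_arg_min (h 1) (\<lambda>_. True) y \<and>
           h 1 yt - h 1 y \<le> - (ereal (\<tau> / 2) * h \<gamma> yt) \<and>
           accept i \<and> (\<forall>j<i. \<not> accept j) \<and>
           xnext = (if f yt < f xl then yt else xl))"

definition VMILAn_sequences ::
  "(real ^ 'n \<Rightarrow> real) \<Rightarrow> (real ^ 'n \<Rightarrow> ereal) \<Rightarrow>
   real \<Rightarrow> real \<Rightarrow> real \<Rightarrow> real \<Rightarrow> real \<Rightarrow> real \<Rightarrow> real \<Rightarrow>
   (nat \<Rightarrow> real ^ 'n) \<Rightarrow> (nat \<Rightarrow> real ^ 'n) \<Rightarrow> bool" where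
  "VMILAn_sequences f0 f1 \<alpha>min \<alpha>max \<mu> \<delta> \<beta> \<gamma> \<tau> x yt \<longleftrightarrow>
     0 < \<alpha>min \<and> \<alpha>min \<le> \<alpha>max \<and> 1 \<le> \<mu> \<and> \<delta> \<in> {0<..<1} \<and> \<beta> \<in> {0<..<1} \<and>
     \<gamma> \<in> {0..1} \<and> 0 < \<tau> \<and> x 0 \<in> effdom f1 \<and>
     (\<forall>k. VMILAn_step f0 f1 \<alpha>min \<alpha>max \<mu> \<delta> \<beta> \<gamma> \<tau> (x k) (yt k) (x (Suc k)))"

end

theory Submission
  imports Defs
begin

text \<open>
  With \<open>\<eta> = - h\<^sub>\<gamma>(yt)\<close>, strong convexity of the model \<open>h\<^sub>1\<close> gives \<open>\<parallel>yt - x\<parallel>\<^sup>2 \<le> K * \<eta>\<close>; together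
  with the descent lemma this bounds the line-search steps away from \<open>0\<close>, so that \<open>f\<close> decreases by
  at least a multiple of \<open>\<eta>\<close> in each iteration and \<open>\<eta> \<longlonglongrightarrow> 0\<close>. Comparing \<open>yt\<close> with \<open>xbar\<close> in the
  model yields \<open>f xbar = lim f (x k)\<close>, and closedness of the limiting subdifferential yields
  stationarity. Since \<open>f (x (k+1)) \<le> f (yt k)\<close> and \<open>\<phi>'\<close> is decreasing, the KL inequality at \<open>yt k\<close>
  can be used at the level \<open>f (x (k+1))\<close>; with \<open>\<Delta> k = \<parallel>x (k+1) - x k\<parallel>\<close> and
  \<open>P k = (b / a) * \<phi> (f (x k) - f xbar)\<close> it gives
  \<open>2 * \<Delta> (k+1) \<le> \<Delta> k + \<zeta> (k+1) / b + P (k+1) - P (k+2)\<close> as long as \<open>yt k\<close> is near \<open>xbar\<close>, and this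
  recursion itself keeps the iterates near \<open>xbar\<close>.
\<close>

section \<open>Gradients and the descent inequality\<close>

lemma GDERIV_unique:
  assumes "GDERIV f x :> D" "GDERIV f x :> E"
  shows "D = E"
proof -
  have "(\<lambda>h. inner h D) = (\<lambda>h. inner h E)"
    using assms unfolding gderiv_def by (rule has_derivative_unique)
  then have "inner (D - E) (D - E) = 0"
    by (simp add: inner_diff_right fun_eq_iff)
  then show ?thesis by simp
qed

text \<open>The adjoint represents a derivative \<open>f'\<close> as the inner product with
  \<open>adjoint f' 1\<close>; uniqueness then makes the \<open>THE\<close> in \<open>grad\<close>
  denote this vector.\<close>

lemma GDERIV_grad:
  fixes f :: "'a::euclidean_space \<Rightarrow> real"
  assumes "f differentiable (at x)"
  shows "GDERIV f x :> grad f x"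
proof -
  obtain f' where f': "(f has_derivative f') (at x)"
    using assms by (auto simp: differentiable_def)
  then have lin: "linear f'" by (rule has_derivative_linear)
  have "f' = (\<lambda>h. inner h (adjoint f' 1))"
    using adjoint_works[OF lin] by (simp add: fun_eq_iff)
  then have "GDERIV f x :> adjoint f' 1"
    using f' unfolding gderiv_def by simp
  then show ?thesis
    unfolding grad_def by (rule theI) (rule GDERIV_unique[OF _ \<open>GDERIV f x :> adjoint f' 1\<close>])
qed

text \<open>Subtracting the linear and quadratic terms from \<open>f\<close> along the segment
  leaves a function \<open>?g\<close> of the step whose derivative is nonpositive, by Cauchy-Schwarz
  and the Lipschitz bound. Convexity of \<open>C\<close> keeps the segment where both hypotheses
  hold.\<close>

lemma descent_lemma:
  fixes f :: "'a::euclidean_space \<Rightarrow> real"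
  assumes diff: "\<And>z. z \<in> C \<Longrightarrow> f differentiable (at z)"
    and lip: "\<And>y z. y \<in> C \<Longrightarrow> z \<in> C \<Longrightarrow> norm (grad f y - grad f z) \<le> L * norm (y - z)"
    and C: "convex C" "x \<in> C" "x + d \<in> C" and t: "0 \<le> t" "t \<le> 1"
  shows "f (x + t *\<^sub>R d) \<le> f x + t * (grad f x \<bullet> d) + L / 2 * t\<^sup>2 * (norm d)\<^sup>2"
proof -
  let ?g = "\<lambda>s. f (x + s *\<^sub>R d) - s * (grad f x \<bullet> d) - L / 2 * s\<^sup>2 * (norm d)\<^sup>2"
  have seg: "x + s *\<^sub>R d \<in> C" if "0 \<le> s" "s \<le> 1" for s
  proof -
    have "x + s *\<^sub>R d = (1 - s) *\<^sub>R x + s *\<^sub>R (x + d)" by (simp add: algebra_simps)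
    then show ?thesis using convexD_alt[OF C that] by simp
  qed
  have "?g t \<le> ?g 0"
  proof (rule DERIV_nonpos_imp_nonincreasing[OF t(1)])
    fix s assume s: "0 \<le> s" "s \<le> t"
    let ?z = "x + s *\<^sub>R d"
    have z: "?z \<in> C" using s t seg by simp
    have "(f has_derivative (\<lambda>h. h \<bullet> grad f ?z)) (at ?z)"
      using GDERIV_grad[OF diff[OF z]] by (simp only: gderiv_def)
    moreover have "((\<lambda>s. x + s *\<^sub>R d) has_derivative (\<lambda>h. h *\<^sub>R d)) (at s)"
      by (auto intro!: derivative_eq_intros)
    ultimately have "((\<lambda>s. f (x + s *\<^sub>R d)) has_derivative (\<lambda>h. (h *\<^sub>R d) \<bullet> grad f ?z)) (at s)"
      using has_derivative_compose[of "\<lambda>s. x + s *\<^sub>R d" _ s UNIV f] by blast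
    then have "((\<lambda>s. f (x + s *\<^sub>R d)) has_real_derivative (grad f ?z \<bullet> d)) (at s)"
      by (simp add: has_field_derivative_def inner_commute mult_commute_abs)
    then have der: "(?g has_real_derivative
        (grad f ?z \<bullet> d - grad f x \<bullet> d - L * s * (norm d)\<^sup>2)) (at s)"
      by (auto intro!: derivative_eq_intros)
    have "(grad f ?z - grad f x) \<bullet> d \<le> norm (grad f ?z - grad f x) * norm d"
      by (rule norm_cauchy_schwarz)
    also have "\<dots> \<le> (L * norm (?z - x)) * norm d"
      by (intro mult_right_mono lip z C) simp
    also have "\<dots> = L * s * (norm d)\<^sup>2"
      using s by (simp add: power2_eq_square)
    finally show "\<exists>y. (?g has_real_derivative y) (at s) \<and> y \<le> 0"
      using der by (auto simp: inner_diff_left)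
  qed
  then show ?thesis by simp
qed

section \<open>Spectral bounds for the scaling matrices\<close>

lemma symmetric_matrix_inner:
  fixes D :: "real ^ 'n ^ 'n"
  assumes "transpose D = D"
  shows "(D *v x) \<bullet> y = x \<bullet> (D *v y)"
  using assms by (metis dot_lmul_matrix vector_transpose_matrix)

text \<open>A nonnegative form that is zero at \<open>u\<close> has a minimum there, so its first
  variation vanishes: if \<open>w = D *v u\<close> were nonzero, the form at
  \<open>u + t *\<^sub>R w\<close> would be negative for small negative \<open>t\<close>.\<close>

lemma psd_kernel:
  fixes D :: "real ^ 'n ^ 'n"
  assumes sym: "transpose D = D" and psd: "\<And>w. 0 \<le> w \<bullet> (D *v w)" and u: "u \<bullet> (D *v u) = 0"
  shows "D *v u = 0"
proof (rule ccontr)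
  assume ne: "D *v u \<noteq> 0"
  define w where "w = D *v u"
  define a where "a = w \<bullet> w"
  define c where "c = w \<bullet> (D *v w)"
  have a: "a > 0" using ne by (simp add: a_def w_def)
  have c: "c \<ge> 0" using psd by (simp add: c_def)
  have ineq: "0 \<le> 2 * t * a + t\<^sup>2 * c" for t
  proof -
    have "(u + t *\<^sub>R w) \<bullet> (D *v (u + t *\<^sub>R w)) = 2 * t * a + t\<^sup>2 * c"
      using u symmetric_matrix_inner[OF sym, of u w]
      by (simp add: a_def c_def matrix_vector_right_distrib matrix_vector_mult_scaleR
        inner_add_left inner_add_right power2_eq_square algebra_simps flip: w_def)
    then show ?thesis using psd[of "u + t *\<^sub>R w"] by simp
  qed
  \<comment> \<open>Since \<open>c\<close> may be zero, the denominator is \<open>c + 1\<close>; the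
    resulting \<open>t\<close> is small enough that the quadratic term cannot offset the linear
    one.\<close>
  have "0 \<le> 2 * (- (a / (c + 1))) * a + (- (a / (c + 1)))\<^sup>2 * c" by (rule ineq)
  also have "\<dots> = - (a\<^sup>2 * (c + 2) / (c + 1)\<^sup>2)"
    using c by (simp add: divide_simps power2_eq_square) (simp add: algebra_simps)
  also have "\<dots> < 0" using a c by simp
  finally show False by simp
qed

text \<open>The minimum \<open>l\<close> of the form on the unit sphere is an eigenvalue: shifting
  \<open>D\<close> by \<open>l\<close> gives a positive semidefinite form that vanishes at the
  minimiser \<open>u\<close>, so \<open>psd_kernel\<close> applies.\<close>

lemma rayleigh_lower_bound:
  fixes D :: "real ^ 'n ^ 'n"
  assumes sym: "transpose D = D"
    and eig: "\<And>l x. x \<noteq> 0 \<Longrightarrow> D *v x = l *\<^sub>R x \<Longrightarrow> m \<le> l"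
  shows "m * (norm x)\<^sup>2 \<le> x \<bullet> (D *v x)"
proof -
  let ?q = "\<lambda>x. x \<bullet> (D *v x)"
  have "continuous_on (sphere 0 1) ?q"
    by (intro continuous_intros)
  moreover have "sphere (0::real^'n) 1 \<noteq> {}" by simp
  ultimately obtain u where u: "norm u = 1" and umin: "\<And>w. norm w = 1 \<Longrightarrow> ?q u \<le> ?q w"
    using continuous_attains_inf[of "sphere 0 1" ?q] by auto
  define l where "l = ?q u"
  have low: "l * (norm w)\<^sup>2 \<le> ?q w" for w
  proof (cases "w = 0")
    case False
    have "l \<le> ?q (w /\<^sub>R norm w)" unfolding l_def using False by (intro umin) simp
    also have "\<dots> = ?q w / (norm w)\<^sup>2"
      by (simp add: matrix_vector_mult_scaleR power2_eq_square field_simps)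
    finally show ?thesis using False by (simp add: field_simps)
  qed simp
  let ?B = "D - l *\<^sub>R mat 1"
  have B: "?B *v w = D *v w - l *\<^sub>R w" for w
    by (simp add: matrix_vector_mult_diff_rdistrib scaleR_matrix_vector_assoc[symmetric])
  have "?B *v u = 0"
  proof (rule psd_kernel)
    show "transpose ?B = ?B"
      using sym by (simp add: transpose_def vec_eq_iff mat_def)
    show "0 \<le> w \<bullet> (?B *v w)" for w
      using low[of w] by (simp add: B inner_diff_right power2_norm_eq_inner)
    show "u \<bullet> (?B *v u) = 0"
      using u unfolding B by (simp add: inner_diff_right l_def power2_norm_eq_inner[symmetric])
  qed
  then have "D *v u = l *\<^sub>R u" by (simp add: B)
  moreover have "u \<noteq> 0" using u by auto
  ultimately have "m \<le> l" by (rule eig[rotated])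
  then have "m * (norm x)\<^sup>2 \<le> l * (norm x)\<^sup>2" by (simp add: mult_right_mono)
  with low[of x] show ?thesis by linarith
qed

lemma scaling_matrices_bounds:
  fixes D :: "real ^ 'n ^ 'n"
  assumes "D \<in> scaling_matrices \<mu>"
  shows "1 / \<mu> * (norm x)\<^sup>2 \<le> (norm_mat D x)\<^sup>2" "(norm_mat D x)\<^sup>2 \<le> \<mu> * (norm x)\<^sup>2"
    "(norm_mat D x)\<^sup>2 = x \<bullet> (D *v x)"
proof -
  have sym: "transpose D = D" and pos: "\<And>x. x \<noteq> 0 \<Longrightarrow> 0 < x \<bullet> (D *v x)"
    and eig: "\<And>l x. x \<noteq> 0 \<Longrightarrow> D *v x = l *\<^sub>R x \<Longrightarrow> 1 / \<mu> \<le> l \<and> l \<le> \<mu>"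
    using assms by (auto simp: scaling_matrices_def)
  have "0 \<le> x \<bullet> (D *v x)" using pos[of x] by (cases "x = 0") auto
  then show eq: "(norm_mat D x)\<^sup>2 = x \<bullet> (D *v x)" by (simp add: norm_mat_def)
  show "1 / \<mu> * (norm x)\<^sup>2 \<le> (norm_mat D x)\<^sup>2"
    unfolding eq by (rule rayleigh_lower_bound[OF sym]) (use eig in blast)
  \<comment> \<open>The upper bound is the lower bound applied to \<open>- D\<close>, whose
    eigenvalues are at least \<open>- \<mu>\<close>.\<close>
  have neg: "(- D) *v x = - (D *v x)" for x
    by (simp add: matrix_vector_mult_def vec_eq_iff sum_negf)
  have "- \<mu> * (norm x)\<^sup>2 \<le> x \<bullet> ((- D) *v x)"
  proof (rule rayleigh_lower_bound)
    show "transpose (- D) = - D" using sym by (simp add: transpose_def vec_eq_iff)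
    show "- \<mu> \<le> l" if "x \<noteq> 0" "(- D) *v x = l *\<^sub>R x" for l x
    proof -
      have "D *v x = (- l) *\<^sub>R x" using that neg[of x] by (metis minus_minus scaleR_minus_left)
      then show ?thesis using eig[OF that(1)] by fastforce
    qed
  qed
  then show "(norm_mat D x)\<^sup>2 \<le> \<mu> * (norm x)\<^sup>2" by (simp add: eq neg)
qed

section \<open>Strong convexity of the model\<close>

text \<open>The last term is the exact gain over plain convexity, from which the quadratic growth of
  the model is obtained.\<close>

lemma quadratic_form_convex_combination:
  fixes D :: "real ^ 'n ^ 'n"
  assumes "transpose D = D"
  shows "((1 - t) *\<^sub>R a + t *\<^sub>R b) \<bullet> (D *v ((1 - t) *\<^sub>R a + t *\<^sub>R b)) =
    (1 - t) * (a \<bullet> (D *v a)) + t * (b \<bullet> (D *v b)) - t * (1 - t) * ((b - a) \<bullet> (D *v (b - a)))"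
proof -
  have "b \<bullet> (D *v a) = a \<bullet> (D *v b)"
    using symmetric_matrix_inner[OF assms, of a b] by (simp add: inner_commute)
  then show ?thesis
    by (simp add: matrix_vector_right_distrib matrix_vector_mult_diff_distrib matrix_vector_mult_scaleR
        inner_add_left inner_add_right inner_diff_left inner_diff_right) (simp add: algebra_simps)
qed

text \<open>Comparing the minimiser \<open>y\<close> with
  \<open>(1 - t) *\<^sub>R y + t *\<^sub>R z\<close> and dividing by \<open>t\<close> gives the
  claim up to a factor \<open>1 - t\<close> on the quadratic gain; then \<open>t\<close> tends to 0
  from the right.\<close>

lemma prox_quadratic_growth:
  fixes D :: "real ^ 'n ^ 'n" and F :: "real ^ 'n \<Rightarrow> real"
  assumes sym: "transpose D = D" and a: "0 \<le> a" and C: "convex_on C F" "y \<in> C" "z \<in> C"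
    and H: "\<And>w. H w = g \<bullet> (w - x) + a * ((w - x) \<bullet> (D *v (w - x))) + F w"
    and min: "\<And>w. w \<in> C \<Longrightarrow> H y \<le> H w"
  shows "H y + a * ((z - y) \<bullet> (D *v (z - y))) \<le> H z"
proof -
  let ?q = "(z - y) \<bullet> (D *v (z - y))"
  have "(1 - t) * (a * ?q) \<le> H z - H y" if t: "0 < t" "t < 1" for t
  proof -
    let ?w = "(1 - t) *\<^sub>R y + t *\<^sub>R z"
    have wx: "?w - x = (1 - t) *\<^sub>R (y - x) + t *\<^sub>R (z - x)" by (simp add: algebra_simps)
    have w: "?w \<in> C"
      using convexD_alt[OF convex_on_imp_convex[OF C(1)] C(2,3)] t by simp
    have F: "F ?w \<le> (1 - t) * F y + t * F z" using convex_onD[OF C(1), of t y z] C t by simp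
    have "H ?w = g \<bullet> (?w - x) + a * ((?w - x) \<bullet> (D *v (?w - x))) + F ?w" by (rule H)
    also have "\<dots> \<le> (1 - t) * H y + t * H z - t * (1 - t) * (a * ?q)"
      unfolding wx H using F
      by (subst quadratic_form_convex_combination[OF sym])
        (simp add: inner_add_right inner_diff_right algebra_simps)
    finally have "H y \<le> (1 - t) * H y + t * H z - t * (1 - t) * (a * ?q)"
      using min[OF w] by linarith
    then have "t * ((1 - t) * (a * ?q)) \<le> t * (H z - H y)" by (simp add: algebra_simps)
    then show ?thesis using t by (simp add: mult_le_cancel_left)
  qed
  then have ev: "eventually (\<lambda>t. (1 - t) * (a * ?q) \<le> H z - H y) (at_right 0)"
    by (auto simp: eventually_at_right[of 0 1] intro!: exI[of _ 1])
  have "((\<lambda>t. (1 - t) * (a * ?q)) \<longlongrightarrow> (1 - 0) * (a * ?q)) (at_right (0::real))"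
    by (intro tendsto_intros)
  from tendsto_upperbound[OF this ev] show ?thesis by simp
qed

section \<open>Real values of proper convex functions\<close>

lemma proper_fun_ereal_real:
  assumes "proper_fun f" "z \<in> effdom f"
  shows "f z = ereal (real_of_ereal (f z))"
  using assms by (cases "f z") (auto simp: proper_fun_def effdom_def)

text \<open>Bridge from extended-valued convexity to \<open>convex_on\<close>. The finite right-hand
  side of \<open>key\<close> also shows that the domain is convex.\<close>

lemma convex_on_effdom:
  assumes p: "proper_fun f" and c: "convex_fun f"
  shows "convex_on (effdom f) (\<lambda>z. real_of_ereal (f z))"
proof -
  let ?F = "\<lambda>z. real_of_ereal (f z)"
  have key: "f ((1 - t) *\<^sub>R x + t *\<^sub>R y) \<le> ereal ((1 - t) * ?F x + t * ?F y)"
    if "x \<in> effdom f" "y \<in> effdom f" "0 \<le> t" "t \<le> 1" for x y t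
  proof -
    have "f ((1 - t) *\<^sub>R x + t *\<^sub>R y) \<le> ereal (1 - t) * f x + ereal t * f y"
      using c that by (simp add: convex_fun_def)
    also have "\<dots> = ereal ((1 - t) * ?F x + t * ?F y)"
      by (subst (1 2) proper_fun_ereal_real[OF p]) (use that in auto)
    finally show ?thesis .
  qed
  have dom: "(1 - t) *\<^sub>R x + t *\<^sub>R y \<in> effdom f"
    if "x \<in> effdom f" "y \<in> effdom f" "0 \<le> t" "t \<le> 1" for x y t
    using key[OF that] by (auto simp: effdom_def intro: le_less_trans)
  show ?thesis
  proof (rule convex_onI)
    show "convex (effdom f)" by (auto simp: convex_alt dom)
    show "?F ((1 - t) *\<^sub>R x + t *\<^sub>R y) \<le> (1 - t) * ?F x + t * ?F y"
      if "0 < t" "t < 1" "x \<in> effdom f" "y \<in> effdom f" for t x y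
      using key[of x y t] proper_fun_ereal_real[OF p dom[of x y t]] that
      by (metis ereal_less_eq(3) less_imp_le)
  qed
qed

section \<open>Estimates for one iteration\<close>

text \<open>Collects what the convergence analysis uses from one iteration. The step's own
  \<open>\<alpha>\<close>, \<open>D\<close>, \<open>y\<close> and line-search exponent are
  eliminated; the constants depend only on \<open>L\<close> and the parameters, hence are uniform
  over the iterations.\<close>

lemma VMILAn_step_estimates:
  fixes f0 :: "real ^ 'n \<Rightarrow> real" and f1 :: "real ^ 'n \<Rightarrow> ereal" and x yt xnext :: "real ^ 'n"
    and L \<alpha>min \<alpha>max \<mu> \<delta> \<beta> \<gamma> \<tau> :: real
  defines "F1 \<equiv> \<lambda>z. real_of_ereal (f1 z)"
  defines "F \<equiv> \<lambda>z. f0 z + F1 z"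
  defines "K \<equiv> 4 * \<alpha>max * \<mu> * (1 + \<tau>)"
  assumes f1: "proper_fun f1" "convex_fun f1"
    and diff: "\<And>z. z \<in> effdom f1 \<Longrightarrow> f0 differentiable (at z)"
    and lip: "L > 0"
      "\<And>y z. y \<in> effdom f1 \<Longrightarrow> z \<in> effdom f1 \<Longrightarrow>
         norm (grad f0 y - grad f0 z) \<le> L * norm (y - z)"
    and pars: "0 < \<alpha>min" "\<alpha>min \<le> \<alpha>max" "1 \<le> \<mu>" "\<delta> \<in> {0<..<1}" "\<beta> \<in> {0<..<1}" "\<gamma> \<in> {0..1}" "0 < \<tau>"
    and step: "VMILAn_step f0 f1 \<alpha>min \<alpha>max \<mu> \<delta> \<beta> \<gamma> \<tau> x yt xnext"
    and x: "x \<in> effdom f1" and yt: "yt \<in> effdom f1"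
  obtains \<eta> where "0 \<le> \<eta>" "(norm (yt - x))\<^sup>2 \<le> K * \<eta>" "xnext \<in> effdom f1"
    "F xnext \<le> F x - \<beta> * min 1 (2 * \<delta> * (1 - \<beta>) / (L * K)) * \<eta>"
    "F xnext \<le> F yt" "F yt \<le> F x + L / 2 * K * \<eta>" "norm (xnext - x) \<le> norm (yt - x)"
    "\<And>z. z \<in> effdom f1 \<Longrightarrow>
      F1 yt \<le> F1 z + grad f0 x \<bullet> (z - yt) + \<mu> / (2 * \<alpha>min) * (norm (z - x))\<^sup>2 + \<tau> / 2 * \<eta>"
proof -
  let ?C = "effdom f1" and ?g = "grad f0 x"
  have F1: "f1 z = ereal (F1 z)" if "z \<in> ?C" for z
    unfolding F1_def using that by (rule proper_fun_ereal_real[OF f1(1)])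
  have F1_convex: "convex_on ?C F1" unfolding F1_def using f1 by (rule convex_on_effdom)
  note C = convex_on_imp_convex[OF F1_convex]
  have K: "K > 0" using pars unfolding K_def by (intro mult_pos_pos) auto
  obtain \<alpha> D y i where \<alpha>: "\<alpha> \<in> {\<alpha>min..\<alpha>max}" and D: "D \<in> scaling_matrices \<mu>"
    and y: "is_arg_min (hmodel f0 f1 \<alpha> D x 1) (\<lambda>_. True) y"
    and inexact: "hmodel f0 f1 \<alpha> D x 1 yt - hmodel f0 f1 \<alpha> D x 1 y
        \<le> - (ereal (\<tau> / 2) * hmodel f0 f1 \<alpha> D x \<gamma> yt)"
    and acc: "ereal (f0 (x + \<delta> ^ i *\<^sub>R (yt - x))) + f1 (x + \<delta> ^ i *\<^sub>R (yt - x))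
        \<le> ereal (f0 x) + f1 x + ereal (\<beta> * \<delta> ^ i) * hmodel f0 f1 \<alpha> D x \<gamma> yt"
    and rej: "\<And>j. j < i \<Longrightarrow> \<not> ereal (f0 (x + \<delta> ^ j *\<^sub>R (yt - x))) + f1 (x + \<delta> ^ j *\<^sub>R (yt - x))
        \<le> ereal (f0 x) + f1 x + ereal (\<beta> * \<delta> ^ j) * hmodel f0 f1 \<alpha> D x \<gamma> yt"
    and xnext: "xnext = (if ereal (f0 yt) + f1 yt
        < ereal (f0 (x + \<delta> ^ i *\<^sub>R (yt - x))) + f1 (x + \<delta> ^ i *\<^sub>R (yt - x))
        then yt else x + \<delta> ^ i *\<^sub>R (yt - x))"
    using step unfolding VMILAn_step_def Let_def by blast
  have \<alpha>pos: "0 < \<alpha>" using \<alpha> pars by simp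
  have sym: "transpose D = D" using D by (simp add: scaling_matrices_def)
  note q = scaling_matrices_bounds[OF D]
  define H where "H c z = ?g \<bullet> (z - x) + c / (2 * \<alpha>) * (norm_mat D (z - x))\<^sup>2 + F1 z - F1 x" for c z
  have H: "hmodel f0 f1 \<alpha> D x c z = ereal (H c z)" if "z \<in> ?C" for c z
    using F1[OF that] F1[OF x] by (simp add: hmodel_def H_def)
  define \<eta> where "\<eta> = - H \<gamma> yt"

  have y_min: "hmodel f0 f1 \<alpha> D x 1 y \<le> hmodel f0 f1 \<alpha> D x 1 z" for z
    using y by (auto simp: is_arg_min_def not_less)
  have y_dom: "y \<in> ?C"
  proof (rule ccontr)
    assume "y \<notin> ?C"
    then have "hmodel f0 f1 \<alpha> D x 1 y = \<infinity>"
      using F1[OF x] by (simp add: hmodel_def effdom_def)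
    then show False using y_min[of x] H[OF x] by simp
  qed
  have Hmin: "H 1 y \<le> H 1 z" if "z \<in> ?C" for z
    using y_min[of z] H[OF y_dom] H[OF that] by simp
  have inexact': "H 1 yt - H 1 y \<le> \<tau> / 2 * \<eta>"
    using inexact by (simp add: H[OF y_dom] H[OF yt] \<eta>_def)
  \<comment> \<open>The sign of \<open>\<eta>\<close> comes from the inexactness test itself: its
    left side is nonnegative because \<open>y\<close> is a minimiser.\<close>
  have "0 \<le> \<tau> / 2 * \<eta>" using inexact' Hmin[OF yt] by linarith
  then have \<eta>: "0 \<le> \<eta>" using pars by (simp add: zero_le_mult_iff)
  have H\<gamma>: "H \<gamma> yt \<le> H 1 yt"
    using pars \<alpha>pos unfolding H_def
    by (intro diff_right_mono add_right_mono add_left_mono mult_right_mono divide_right_mono) auto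
  have Hx: "H 1 x = 0" by (simp add: H_def norm_mat_def)

  \<comment> \<open>\<open>m\<close> is a strong convexity modulus valid for every admissible
    \<open>\<alpha>\<close> and \<open>D\<close>: the eigenvalues are at least
    \<open>1 / \<mu>\<close> and \<open>\<alpha> \<le> \<alpha>max\<close>.\<close>
  define m where "m = 1 / (2 * \<alpha>max * \<mu>)"
  have m: "m > 0" using pars by (simp add: m_def)
  have mq: "m * (norm w)\<^sup>2 \<le> 1 / (2 * \<alpha>) * (norm_mat D w)\<^sup>2" for w
  proof -
    have "m * (norm w)\<^sup>2 = 1 / (2 * \<alpha>max) * (1 / \<mu> * (norm w)\<^sup>2)" by (simp add: m_def)
    also have "\<dots> \<le> 1 / (2 * \<alpha>) * (norm_mat D w)\<^sup>2"
      using \<alpha> pars \<alpha>pos by (intro mult_mono q frac_le) auto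
    finally show ?thesis .
  qed
  have growth: "H 1 y + m * (norm (z - y))\<^sup>2 \<le> H 1 z" if "z \<in> ?C" for z
  proof -
    have "H 1 y + 1 / (2 * \<alpha>) * ((z - y) \<bullet> (D *v (z - y))) \<le> H 1 z"
    proof (rule prox_quadratic_growth[OF sym])
      show "convex_on ?C (\<lambda>w. F1 w + (- F1 x))"
        using F1_convex C by (intro convex_on_add) (simp_all add: convex_on_const)
      show "H 1 w = ?g \<bullet> (w - x) + 1 / (2 * \<alpha>) * ((w - x) \<bullet> (D *v (w - x))) + (F1 w + (- F1 x))" for w
        by (simp add: H_def q(3))
    qed (use \<alpha>pos y_dom that Hmin in auto)
    with mq[of "z - y"] show ?thesis by (simp add: q(3))
  qed
  \<comment> \<open>The distance from \<open>x\<close> to \<open>yt\<close> is estimated through the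
    exact minimiser \<open>y\<close>, with growth used at \<open>yt\<close> and at \<open>x\<close>,
    where the model is 0. The two bounds add up to \<open>2 * (1 + \<tau>) * \<eta>\<close>, and
    division by \<open>m\<close> produces \<open>K\<close>.\<close>
  have "m * (norm (yt - y))\<^sup>2 \<le> \<tau> / 2 * \<eta>" using growth[OF yt] inexact' by linarith
  moreover have "m * (norm (x - y))\<^sup>2 \<le> (\<tau> / 2 + 1) * \<eta>"
    using growth[OF x] inexact' H\<gamma> Hx by (simp add: \<eta>_def algebra_simps)
  moreover have "(norm (yt - x))\<^sup>2 \<le> 2 * (norm (yt - y))\<^sup>2 + 2 * (norm (x - y))\<^sup>2"
  proof -
    have "(norm (yt - x))\<^sup>2 \<le> (norm (yt - y) + norm (x - y))\<^sup>2"
      using norm_triangle_ineq4[of "yt - y" "x - y"] by (intro power_mono) auto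
    also have "\<dots> \<le> 2 * (norm (yt - y))\<^sup>2 + 2 * (norm (x - y))\<^sup>2"
      using sum_squares_bound[of "norm (yt - y)" "norm (x - y)"] by (simp add: power2_sum)
    finally show ?thesis .
  qed
  then have "m * (norm (yt - x))\<^sup>2 \<le> m * (2 * (norm (yt - y))\<^sup>2 + 2 * (norm (x - y))\<^sup>2)"
    using m by (intro mult_left_mono) auto
  ultimately have "m * (norm (yt - x))\<^sup>2 \<le> 2 * (1 + \<tau>) * \<eta>" by (simp add: algebra_simps)
  then have dist: "(norm (yt - x))\<^sup>2 \<le> K * \<eta>"
    using pars by (simp add: m_def K_def field_simps)

  have seg: "x + s *\<^sub>R (yt - x) \<in> ?C" if "0 \<le> s" "s \<le> 1" for s
    using convexD_alt[OF C x yt that] by (simp add: algebra_simps)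
  \<comment> \<open>The smooth part is bounded by the descent lemma and \<open>F1\<close> by
    convexity; dropping the nonnegative quadratic term of the model leaves a decrease of at least
    \<open>s * \<eta>\<close> to first order.\<close>
  have descent: "F (x + s *\<^sub>R (yt - x)) \<le> F x - s * \<eta> + L / 2 * s\<^sup>2 * (K * \<eta>)" if s: "0 \<le> s" "s \<le> 1" for s
  proof -
    have "f0 (x + s *\<^sub>R (yt - x)) \<le> f0 x + s * (?g \<bullet> (yt - x)) + L / 2 * s\<^sup>2 * (norm (yt - x))\<^sup>2"
      by (rule descent_lemma[OF diff lip(2) C x _ s]) (use yt in auto)
    also have "\<dots> \<le> f0 x + s * (?g \<bullet> (yt - x)) + L / 2 * s\<^sup>2 * (K * \<eta>)"
      using lip dist by (intro add_left_mono mult_left_mono) auto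
    finally have 1: "f0 (x + s *\<^sub>R (yt - x)) \<le> f0 x + s * (?g \<bullet> (yt - x)) + L / 2 * s\<^sup>2 * (K * \<eta>)" .
    have 2: "F1 (x + s *\<^sub>R (yt - x)) \<le> (1 - s) * F1 x + s * F1 yt"
      using convex_onD[OF F1_convex s x yt] by (simp add: algebra_simps)
    have "?g \<bullet> (yt - x) + F1 yt - F1 x \<le> - \<eta>"
      using pars \<alpha>pos by (simp add: \<eta>_def H_def)
    then have "s * (?g \<bullet> (yt - x) + F1 yt - F1 x) \<le> s * (- \<eta>)" using s by (intro mult_left_mono)
    then show ?thesis using 1 2 by (simp add: F_def algebra_simps)
  qed

  have \<delta>: "0 \<le> \<delta> ^ j" "\<delta> ^ j \<le> 1" "0 < \<delta> ^ j" for j using pars by (auto simp: power_le_one)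
  define xl where "xl = x + \<delta> ^ i *\<^sub>R (yt - x)"
  have xl: "xl \<in> ?C" unfolding xl_def using \<delta> by (intro seg)
  have acc_iff: "ereal (f0 (x + \<delta> ^ j *\<^sub>R (yt - x))) + f1 (x + \<delta> ^ j *\<^sub>R (yt - x))
        \<le> ereal (f0 x) + f1 x + ereal (\<beta> * \<delta> ^ j) * hmodel f0 f1 \<alpha> D x \<gamma> yt
      \<longleftrightarrow> F (x + \<delta> ^ j *\<^sub>R (yt - x)) \<le> F x - \<beta> * \<delta> ^ j * \<eta>" for j
    by (simp add: F1[OF x] F1[OF seg[OF \<delta>(1,2)]] H[OF yt] \<eta>_def F_def)
  have F_xl: "F xl \<le> F x - \<beta> * \<delta> ^ i * \<eta>" using acc unfolding acc_iff xl_def .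
  \<comment> \<open>For \<open>i > 0\<close> the exponent \<open>i - 1\<close> was rejected; against
    \<open>descent\<close> this bounds \<open>\<delta> ^ (i - 1)\<close> from below, and one factor
    \<open>\<delta>\<close> is lost. The factor \<open>\<eta>\<close> on both sides makes the case
    \<open>\<eta> = 0\<close> trivial.\<close>
  have stepsize: "min 1 (2 * \<delta> * (1 - \<beta>) / (L * K)) * \<eta> \<le> \<delta> ^ i * \<eta>"
  proof (cases "i = 0 \<or> \<eta> = 0")
    case True
    then show ?thesis using \<eta> mult_right_mono[of "min 1 (2 * \<delta> * (1 - \<beta>) / (L * K))" 1 \<eta>] by auto
  next
    case False
    then obtain j where j: "i = Suc j" by (cases i) auto
    have "\<eta> > 0" using False \<eta> by simp
    have "F x - \<beta> * \<delta> ^ j * \<eta> < F (x + \<delta> ^ j *\<^sub>R (yt - x))"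
      using rej[of j] unfolding acc_iff j by simp
    with descent[OF \<delta>(1,2), of j]
    have "\<delta> ^ j * \<eta> * (1 - \<beta>) < \<delta> ^ j * \<eta> * (L / 2 * K * \<delta> ^ j)"
      by (simp add: algebra_simps power2_eq_square)
    then have "1 - \<beta> < L / 2 * K * \<delta> ^ j" using \<open>\<eta> > 0\<close> \<delta>(3)[of j] by simp
    then have "2 * (1 - \<beta>) / (L * K) \<le> \<delta> ^ j" using lip K by (simp add: field_simps)
    then have "\<delta> * (2 * (1 - \<beta>) / (L * K)) \<le> \<delta> * \<delta> ^ j" using pars by (intro mult_left_mono) auto
    then have "min 1 (2 * \<delta> * (1 - \<beta>) / (L * K)) \<le> \<delta> ^ i" by (simp add: j mult_ac min.coboundedI2)
    then show ?thesis using \<eta> by (rule mult_right_mono)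
  qed
  \<comment> \<open>The iteration keeps the better of its two candidates, so both bounds hold in
    either branch.\<close>
  have F_xnext: "F xnext \<le> F xl" "F xnext \<le> F yt"
    using xnext F1[OF yt] F1[OF xl] by (auto simp: F_def xl_def split: if_splits)
  show ?thesis
  proof (rule that[of \<eta>])
    show "xnext \<in> ?C" using xnext yt xl by (simp add: xl_def split: if_splits)
    have "\<beta> * (min 1 (2 * \<delta> * (1 - \<beta>) / (L * K)) * \<eta>) \<le> \<beta> * (\<delta> ^ i * \<eta>)"
      using stepsize pars by (intro mult_left_mono) auto
    then show "F xnext \<le> F x - \<beta> * min 1 (2 * \<delta> * (1 - \<beta>) / (L * K)) * \<eta>"
      using F_xnext(1) F_xl by (simp add: mult.assoc)
    show "F yt \<le> F x + L / 2 * K * \<eta>" using descent[of 1] \<eta> by simp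
    show "norm (xnext - x) \<le> norm (yt - x)"
      using xnext \<delta>(1,2)[of i] by (auto simp: mult_left_le_one_le split: if_splits)
    \<comment> \<open>Near-minimality of \<open>yt\<close> in the model: the quadratic term at
      \<open>yt\<close> is dropped, the one at \<open>z\<close> is bounded by the largest eigenvalue
      and \<open>\<alpha> \<ge> \<alpha>min\<close>.\<close>
    show "F1 yt \<le> F1 z + ?g \<bullet> (z - yt) + \<mu> / (2 * \<alpha>min) * (norm (z - x))\<^sup>2 + \<tau> / 2 * \<eta>"
      if z: "z \<in> ?C" for z
    proof -
      have "H 1 yt \<le> H 1 z + \<tau> / 2 * \<eta>" using Hmin[OF z] inexact' by linarith
      moreover have "1 / (2 * \<alpha>) * (norm_mat D (z - x))\<^sup>2 \<le> 1 / (2 * \<alpha>min) * (\<mu> * (norm (z - x))\<^sup>2)"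
        using \<alpha> pars \<alpha>pos by (intro mult_mono q frac_le) auto
      moreover have "0 \<le> 1 / (2 * \<alpha>) * (norm_mat D (yt - x))\<^sup>2" using \<alpha>pos by simp
      ultimately show ?thesis by (simp add: H_def inner_diff_right)
    qed
  qed (use \<eta> dist F_xnext in auto)
qed

section \<open>Lower semicontinuity and closedness of the limiting subdifferential\<close>

lemma lsc_fun_le_limit:
  assumes lsc: "lsc_fun f" and z: "z \<longlonglongrightarrow> x" and l: "(\<lambda>k. f (z k)) \<longlonglongrightarrow> l"
  shows "f x \<le> l"
proof (rule dense_le)
  fix c assume c: "c < f x"
  then have "c < Liminf (at x) f" using lsc unfolding lsc_fun_def by (blast intro: less_le_trans)
  then have "eventually (\<lambda>y. c < f y) (at x)" by (rule less_LiminfD)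
  \<comment> \<open>\<open>at x\<close> is punctured, but the sequence may hit \<open>x\<close>;
    since \<open>c < f x\<close>, the bound extends to the full neighbourhood filter.\<close>
  then have "eventually (\<lambda>y. c < f y) (nhds x)"
    unfolding eventually_at_filter by (rule eventually_mono) (use c in auto)
  then have "eventually (\<lambda>k. c < f (z k)) sequentially"
    using z by (rule eventually_compose_filterlim)
  then have "eventually (\<lambda>k. c \<le> f (z k)) sequentially"
    by (rule eventually_mono) simp
  then show "c \<le> l" by (intro tendsto_lowerbound[OF l]) auto
qed

lemma proper_fun_tendsto_real:
  assumes "proper_fun f" "\<And>k. z k \<in> effdom f" "x \<in> effdom f"
  shows "((\<lambda>k. f (z k)) \<longlongrightarrow> f x) A \<longleftrightarrow>
    ((\<lambda>k. real_of_ereal (f (z k))) \<longlongrightarrow> real_of_ereal (f x)) A"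
proof -
  define g where "g k = real_of_ereal (f (z k))" for k
  define c where "c = real_of_ereal (f x)"
  have "f (z k) = ereal (g k)" for k unfolding g_def by (rule proper_fun_ereal_real[OF assms(1,2)])
  moreover have "f x = ereal c" unfolding c_def by (rule proper_fun_ereal_real[OF assms(1,3)])
  ultimately show ?thesis by simp
qed

lemma proper_fun_abs_diff:
  assumes "proper_fun f" "y \<in> effdom f" "x \<in> effdom f"
  shows "\<bar>f y - f x\<bar> = ereal \<bar>real_of_ereal (f y) - real_of_ereal (f x)\<bar>"
  using assms by (cases "f y"; cases "f x") (auto simp: proper_fun_def effdom_def)

text \<open>Epsilon form of the sequential definition, prepared for the diagonal argument in
  \<open>subdiff_closed\<close>.\<close>

lemma subdiff_approx:
  assumes p: "proper_fun \<Psi>" and v: "v \<in> subdiff \<Psi> x" and e: "(e::real) > 0"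
  obtains y w where "dist y x < e" "\<bar>\<Psi> y - \<Psi> x\<bar> < ereal e" "w \<in> frechet_subdiff \<Psi> y" "dist w v < e"
proof -
  from v obtain y w where x: "x \<in> effdom \<Psi>" and y: "y \<longlonglongrightarrow> x" and \<Psi>: "(\<lambda>k. \<Psi> (y k)) \<longlonglongrightarrow> \<Psi> x"
    and w: "\<And>k::nat. w k \<in> frechet_subdiff \<Psi> (y k)" and v: "w \<longlonglongrightarrow> v"
    unfolding subdiff_def by blast
  have yd: "y k \<in> effdom \<Psi>" for k using w[of k] by (simp add: frechet_subdiff_def)
  have "(\<lambda>k. real_of_ereal (\<Psi> (y k))) \<longlonglongrightarrow> real_of_ereal (\<Psi> x)"
    using \<Psi> by (simp only: proper_fun_tendsto_real[OF p yd x])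
  from tendstoD[OF y e] tendstoD[OF v e] tendstoD[OF this e]
  have "eventually (\<lambda>k. dist (y k) x < e \<and> dist (w k) v < e \<and>
      dist (real_of_ereal (\<Psi> (y k))) (real_of_ereal (\<Psi> x)) < e) sequentially"
    by eventually_elim simp
  then have "\<exists>k. dist (y k) x < e \<and> dist (w k) v < e \<and>
      dist (real_of_ereal (\<Psi> (y k))) (real_of_ereal (\<Psi> x)) < e"
    by (rule eventually_happens'[OF sequentially_bot])
  then obtain k where k: "dist (y k) x < e" "dist (w k) v < e"
      "dist (real_of_ereal (\<Psi> (y k))) (real_of_ereal (\<Psi> x)) < e"
    by blast
  have "\<bar>\<Psi> (y k) - \<Psi> x\<bar> < ereal e"
    using k(3) by (simp add: proper_fun_abs_diff[OF p yd x] dist_real_def)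
  with k w show ?thesis using that by blast
qed

lemma LIMSEQ_dist_le_transform:
  fixes a b :: "nat \<Rightarrow> 'a::metric_space"
  assumes "b \<longlonglongrightarrow> l" "e \<longlonglongrightarrow> 0" and le: "\<And>k. dist (a k) (b k) \<le> e k"
  shows "a \<longlonglongrightarrow> l"
proof (rule metric_tendsto_imp_tendsto)
  show "(\<lambda>k. e k + dist (b k) l) \<longlonglongrightarrow> 0"
    using tendsto_add[OF assms(2) tendsto_dist_iff[THEN iffD1, OF assms(1)]] by simp
  show "\<forall>\<^sub>F k in sequentially. dist (a k) l \<le> dist (e k + dist (b k) l) 0"
  proof (rule always_eventually, rule allI)
    fix k
    show "dist (a k) l \<le> dist (e k + dist (b k) l) 0"
      using dist_triangle[of "a k" l "b k"] le[of k] by (simp add: dist_real_def)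
  qed
qed

text \<open>Diagonal argument: each pair \<open>(y k, w k)\<close> is replaced by a Frechet pair
  that differs by less than \<open>1 / (k + 1)\<close> in point, value and vector, so the limits are
  unchanged.\<close>

lemma subdiff_closed:
  assumes p: "proper_fun \<Psi>" and x: "x \<in> effdom \<Psi>" and y: "y \<longlonglongrightarrow> x"
    and \<Psi>: "(\<lambda>k. \<Psi> (y k)) \<longlonglongrightarrow> \<Psi> x" and w: "\<And>k. w k \<in> subdiff \<Psi> (y k)" and v: "w \<longlonglongrightarrow> v"
  shows "v \<in> subdiff \<Psi> x"
proof -
  define e where "e k = inverse (real (Suc k))" for k
  have e: "0 < e k" for k by (simp add: e_def)
  define Q where "Q k y' w' \<longleftrightarrow> dist y' (y k) < e k \<and> \<bar>\<Psi> y' - \<Psi> (y k)\<bar> < ereal (e k)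
      \<and> w' \<in> frechet_subdiff \<Psi> y' \<and> dist w' (w k) < e k" for k y' w'
  have "\<exists>y' w'. Q k y' w'" for k
    by (rule subdiff_approx[OF p w[of k] e[of k]]) (auto simp only: Q_def)
  then obtain y' w' where Q: "\<And>k. Q k (y' k) (w' k)" by metis
  have *: "dist (y' k) (y k) < e k" "\<bar>\<Psi> (y' k) - \<Psi> (y k)\<bar> < ereal (e k)"
      "w' k \<in> frechet_subdiff \<Psi> (y' k)" "dist (w' k) (w k) < e k" for k
    using Q[of k] by (simp_all only: Q_def)
  have yd: "y k \<in> effdom \<Psi>" for k using w[of k] by (simp add: subdiff_def)
  have yd': "y' k \<in> effdom \<Psi>" for k using *(3)[of k] by (simp add: frechet_subdiff_def)
  have "e \<longlonglongrightarrow> 0" unfolding e_def by (rule LIMSEQ_inverse_real_of_nat)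
  note close = LIMSEQ_dist_le_transform[OF _ this]
  have "(\<lambda>k. real_of_ereal (\<Psi> (y k))) \<longlonglongrightarrow> real_of_ereal (\<Psi> x)"
    using \<Psi> by (simp only: proper_fun_tendsto_real[OF p yd x])
  moreover have "dist (real_of_ereal (\<Psi> (y' k))) (real_of_ereal (\<Psi> (y k))) \<le> e k" for k
    using *(2)[of k] by (simp add: proper_fun_abs_diff[OF p yd' yd] dist_real_def)
  ultimately have "(\<lambda>k. real_of_ereal (\<Psi> (y' k))) \<longlonglongrightarrow> real_of_ereal (\<Psi> x)"
    by (rule close)
  then have "(\<lambda>k. \<Psi> (y' k)) \<longlonglongrightarrow> \<Psi> x"
    by (simp only: proper_fun_tendsto_real[OF p yd' x])
  moreover have "y' \<longlonglongrightarrow> x" by (rule close[OF y less_imp_le[OF *(1)]])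
  moreover have "w' \<longlonglongrightarrow> v" by (rule close[OF v less_imp_le[OF *(4)]])
  ultimately have "\<exists>y w. y \<longlonglongrightarrow> x \<and> (\<lambda>k. \<Psi> (y k)) \<longlonglongrightarrow> \<Psi> x \<and>
      (\<forall>k::nat. w k \<in> frechet_subdiff \<Psi> (y k)) \<and> w \<longlonglongrightarrow> v"
    using *(3) by - (rule exI[of _ y'], rule exI[of _ w'], simp)
  then show ?thesis using x by (simp add: subdiff_def)
qed

section \<open>The Kurdyka-Lojasiewicz inequality and finite length\<close>

text \<open>The level \<open>r\<close> of the point \<open>z\<close> may exceed the levels \<open>s\<close>, \<open>t\<close> that are compared: in the
  algorithm \<open>z\<close> is the trial point \<open>yt k\<close>, while \<open>s\<close> and \<open>t\<close> come from the iterates.\<close>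

lemma KL_desingularization:
  assumes p: "proper_fun f" and KL: "KL_property_at f zb" and c: "f zb = ereal c"
  obtains \<rho> e :: real and \<phi> where "\<rho> > 0" "e > 0" "(\<phi> \<longlongrightarrow> 0) (at_right 0)"
    "\<And>s. 0 < s \<Longrightarrow> s < e \<Longrightarrow> 0 \<le> \<phi> s"
    "\<And>z w r s t. dist z zb < \<rho> \<Longrightarrow> w \<in> subdiff f z \<Longrightarrow> f z = ereal (c + r) \<Longrightarrow>
      0 < t \<Longrightarrow> t \<le> s \<Longrightarrow> s \<le> r \<Longrightarrow> r < e \<Longrightarrow> s - t \<le> norm w * (\<phi> s - \<phi> t)"
proof -
  obtain \<upsilon> U \<phi> \<phi>' where \<upsilon>: "(0::ereal) < \<upsilon>" and U: "zb \<in> interior U"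
    and cont: "continuous_on {s. 0 \<le> s \<and> ereal s < \<upsilon>} \<phi>"
    and conc: "concave_on {s. 0 \<le> s \<and> ereal s < \<upsilon>} \<phi>"
    and nonneg: "\<And>s. 0 \<le> s \<Longrightarrow> ereal s < \<upsilon> \<Longrightarrow> 0 \<le> \<phi> s" and \<phi>0: "\<phi> 0 = 0"
    and deriv: "\<And>s. 0 < s \<Longrightarrow> ereal s < \<upsilon> \<Longrightarrow> (\<phi> has_real_derivative \<phi>' s) (at s)"
    and KL': "\<And>z. z \<in> U \<Longrightarrow> f zb < f z \<Longrightarrow> f z < f zb + \<upsilon> \<Longrightarrow>
           1 \<le> ereal (\<phi>' (real_of_ereal (f z - f zb))) * dist_to_set 0 (subdiff f z)"
    and pos: "\<And>s. 0 < s \<Longrightarrow> ereal s < \<upsilon> \<Longrightarrow> 0 < \<phi>' s"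
    using KL unfolding KL_property_at_def by blast
  \<comment> \<open>\<open>\<upsilon>\<close> may be infinite; a real \<open>e\<close> below it
    makes \<open>{0..<e}\<close> a bounded interval inside the domain of
    \<open>\<phi>\<close>.\<close>
  obtain e where e: "0 < ereal e" "ereal e < \<upsilon>" using ereal_dense2[OF \<upsilon>] by auto
  obtain \<rho> where \<rho>: "\<rho> > 0" "ball zb \<rho> \<subseteq> U" using U by (auto simp: mem_interior)
  have sub: "{0..<e} \<subseteq> {s. 0 \<le> s \<and> ereal s < \<upsilon>}" and lt: "s < e \<Longrightarrow> ereal s < \<upsilon>" for s
    using e(2) by (auto intro: less_trans[of "ereal _" "ereal e"])
  have conv: "convex_on {0..<e} (\<lambda>s. - \<phi> s)"
    using conc sub unfolding concave_on_def by (rule convex_on_subset) simp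
  have tangent: "\<phi> t - \<phi> s \<le> \<phi>' s * (t - s)" if "0 < s" "s < e" "0 \<le> t" "t < e" for s t
  proof -
    have "- \<phi>' s * (t - s) \<le> - \<phi> t - - \<phi> s"
    proof (rule convex_on_imp_above_tangent[OF conv])
      show "((\<lambda>s. - \<phi> s) has_real_derivative - \<phi>' s) (at s within {0..<e})"
        using deriv[OF that(1) lt[OF that(2)]]
        by (intro DERIV_minus) (rule has_field_derivative_at_within)
    qed (use that in auto)
    then show ?thesis by simp
  qed
  \<comment> \<open>Adding the tangent inequalities at \<open>s\<close> and at \<open>r\<close>
    shows that the derivative decreases. This transfers the inequality from the level
    \<open>r\<close> of \<open>z\<close> to the lower level \<open>s\<close>.\<close>
  have anti: "\<phi>' r \<le> \<phi>' s" if "0 < s" "s \<le> r" "r < e" for s r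
  proof (cases "s = r")
    case False
    have "0 \<le> (\<phi>' s - \<phi>' r) * (r - s)"
      using tangent[of s r] tangent[of r s] that by (simp add: algebra_simps)
    then show ?thesis using False that by (simp add: zero_le_mult_iff)
  qed simp
  show ?thesis
  proof (rule that[of \<rho> e \<phi>])
    show "0 < e" using e(1) by simp
    have "{0..e / 2} \<subseteq> {0..<e}" using \<open>0 < e\<close> by auto
    then have "continuous_on {0..e / 2} \<phi>" using continuous_on_subset[OF cont] sub by blast
    then have "(\<phi> \<longlongrightarrow> \<phi> 0) (at 0 within {0..e / 2})"
      using \<open>0 < e\<close> by (simp add: continuous_on_def)
    then show "(\<phi> \<longlongrightarrow> 0) (at_right 0)"
      using at_within_Icc_at_right[of 0 "e / 2"] \<open>0 < e\<close> by (simp add: \<phi>0)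
    show "0 \<le> \<phi> s" if "0 < s" "s < e" for s using nonneg lt that by simp
    show "s - t \<le> norm w * (\<phi> s - \<phi> t)"
      if z: "dist z zb < \<rho>" "w \<in> subdiff f z" "f z = ereal (c + r)"
        and t: "0 < t" "t \<le> s" "s \<le> r" "r < e" for z w r s t
    proof -
      have r: "0 < r" using t by simp
      have "1 \<le> ereal (\<phi>' r) * dist_to_set 0 (subdiff f z)"
      proof -
        have "f zb + ereal r < f zb + \<upsilon>"
          unfolding c using lt[OF t(4)] by (cases \<upsilon>) auto
        then have "f z < f zb + \<upsilon>" by (simp add: z(3) c)
        moreover have "f zb < f z" using r by (simp add: z(3) c)
        moreover have "z \<in> U" using \<rho> z(1) by (auto simp: dist_commute)
        ultimately show ?thesis using KL'[of z] by (simp add: z(3) c)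
      qed
      also have "\<dots> \<le> ereal (\<phi>' r) * ereal (norm w)"
      proof (rule ereal_mult_left_mono)
        show "dist_to_set 0 (subdiff f z) \<le> ereal (norm w)"
          unfolding dist_to_set_def using z(2) by (intro INF_lower2[of w]) auto
        show "0 \<le> ereal (\<phi>' r)" using pos[OF r lt[OF t(4)]] by simp
      qed
      finally have KLr: "1 \<le> \<phi>' r * norm w" by (simp add: one_ereal_def)
      have "\<phi>' r * (s - t) \<le> \<phi>' s * (s - t)" using anti t by (intro mult_right_mono) auto
      also have "\<dots> \<le> \<phi> s - \<phi> t" using tangent[of s t] t by (simp add: algebra_simps)
      finally have "norm w * (\<phi>' r * (s - t)) \<le> norm w * (\<phi> s - \<phi> t)" by (intro mult_left_mono) auto
      moreover have "1 * (s - t) \<le> (\<phi>' r * norm w) * (s - t)"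
        using KLr t by (intro mult_right_mono) auto
      ultimately show ?thesis by (simp add: mult_ac)
    qed
  qed (use \<rho> in auto)
qed

text \<open>Separates the Kurdyka-Lojasiewicz argument from the algorithm: what remains is
  sufficient decrease of \<open>F\<close>, trial values \<open>G k\<close> above the next level
  \<open>F (Suc k)\<close>, and a subgradient bound whose error \<open>z\<close> is already divided
  by \<open>b\<close>.\<close>

lemma KL_finite_length:
  fixes x yt v :: "nat \<Rightarrow> 'a::real_inner" and F G z :: "nat \<Rightarrow> real"
  assumes p: "proper_fun f" and KL: "KL_property_at f xbar" and c: "f xbar = ereal c"
    and a: "a > 0" and b: "b > 0"
    and descent: "\<And>k. F (Suc k) \<le> F k - a * (norm (x (Suc k) - x k))\<^sup>2" and F: "F \<longlonglongrightarrow> c"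
    and G: "\<And>k. f (yt k) = ereal (G k)" "\<And>k. F (Suc k) \<le> G k" "G \<longlonglongrightarrow> c"
    and yt: "(\<lambda>k. yt k - x k) \<longlonglongrightarrow> 0"
    and v: "\<And>k. v k \<in> subdiff f (yt k)" "\<And>k. norm (v k) \<le> b * (norm (x (Suc k) - x k) + z k)"
    and z: "\<And>k. 0 \<le> z k" "summable z"
    and r: "strict_mono r" "(x \<circ> r) \<longlonglongrightarrow> xbar"
  shows "summable (\<lambda>k. norm (x (Suc k) - x k))"
proof -
  define \<Delta> where "\<Delta> k = norm (x (Suc k) - x k)" for k
  have \<Delta>_nonneg: "0 \<le> \<Delta> k" for k by (simp add: \<Delta>_def)
  have descent': "a * (\<Delta> k)\<^sup>2 \<le> F k - F (Suc k)" for k using descent[of k] by (simp add: \<Delta>_def)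
  have dec: "F (Suc k) \<le> F k" for k
    using descent'[of k] a by (smt (verit) mult_nonneg_nonneg zero_le_power2)
  then have decseq: "decseq F" by (rule decseq_SucI)
  have F_ge: "c \<le> F k" for k using decseq_ge[OF decseq F] .
  have summable_\<Delta>: "summable \<Delta>"
  proof (cases "\<exists>m. F m = c")
    \<comment> \<open>If the limit level is reached, \<open>F\<close> is constant from then on and
      sufficient decrease stops the iterates. Otherwise all levels lie strictly above
      \<open>c\<close>, as the inequality requires.\<close>
    case True
    then obtain m where m: "F m = c" by auto
    have "\<Delta> k = 0" if "k \<ge> m" for k
    proof -
      have "F k \<le> c" using decseqD[OF decseq that] m by simp
      then have "a * (\<Delta> k)\<^sup>2 \<le> 0" using descent'[of k] F_ge[of "Suc k"] by linarith
      then show ?thesis using a by (simp add: mult_le_0_iff)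
    qed
    then show ?thesis by (intro summable_finite[of "{..<m}"]) (auto simp: not_less)
  next
    case False
    then have F_gt: "c < F k" for k using F_ge[of k] by (metis order_le_less)
    obtain \<rho> e \<phi> where \<rho>: "\<rho> > 0" and e: "e > 0" and \<phi>_lim: "(\<phi> \<longlongrightarrow> 0) (at_right 0)"
      and \<phi>_nonneg: "\<And>s. 0 < s \<Longrightarrow> s < e \<Longrightarrow> 0 \<le> \<phi> s"
      and KL': "\<And>z w r s t. dist z xbar < \<rho> \<Longrightarrow> w \<in> subdiff f z \<Longrightarrow> f z = ereal (c + r) \<Longrightarrow>
        0 < t \<Longrightarrow> t \<le> s \<Longrightarrow> s \<le> r \<Longrightarrow> r < e \<Longrightarrow> s - t \<le> norm w * (\<phi> s - \<phi> t)"
      by (rule KL_desingularization[OF p KL c]) blast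
    define P where "P k = b / a * \<phi> (F k - c)" for k
    have rec: "2 * \<Delta> (Suc k) \<le> \<Delta> k + z k + (P (Suc k) - P (Suc (Suc k)))"
      if "dist (yt k) xbar < \<rho>" "G k - c < e" for k
    proof -
      define q where "q = \<phi> (F (Suc k) - c) - \<phi> (F (Suc (Suc k)) - c)"
      have 1: "F (Suc k) - F (Suc (Suc k)) \<le> norm (v k) * q"
        using KL'[OF that(1) v(1), of "G k - c" "F (Suc (Suc k)) - c" "F (Suc k) - c"]
          G(1,2)[of k] dec[of "Suc k"] F_gt[of "Suc (Suc k)"] that(2) by (simp add: q_def)
      \<comment> \<open>By \<open>1\<close>, a negative \<open>q\<close> would force the two levels
        to coincide, and then \<open>q\<close> would be 0.\<close>
      have q: "0 \<le> q"
      proof (rule ccontr)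
        assume "\<not> 0 \<le> q"
        then have "norm (v k) * q \<le> 0" by (simp add: mult_le_0_iff)
        then have "F (Suc k) = F (Suc (Suc k))" using 1 dec[of "Suc k"] by linarith
        then show False using \<open>\<not> 0 \<le> q\<close> by (simp add: q_def)
      qed
      have "a * (\<Delta> (Suc k))\<^sup>2 \<le> b * (\<Delta> k + z k) * q"
        using descent'[of "Suc k"] 1 mult_right_mono[OF v(2)[of k] q] by (simp add: \<Delta>_def)
      then have "(\<Delta> (Suc k))\<^sup>2 \<le> (\<Delta> k + z k) * (b / a * q)" using a by (simp add: field_simps)
      \<comment> \<open>Arithmetic-geometric mean inequality, used with
        \<open>\<Delta> k + z k\<close> and \<open>b / a * q\<close>; it turns the bound on the
        square into a linear recursion.\<close>
      moreover have "4 * (s * t) \<le> (s + t)\<^sup>2" for s t :: real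
        using sum_squares_bound[of s t] by (simp add: power2_sum)
      ultimately have "4 * (\<Delta> (Suc k))\<^sup>2 \<le> (\<Delta> k + z k + b / a * q)\<^sup>2"
        by (smt (verit))
      then have "(2 * \<Delta> (Suc k))\<^sup>2 \<le> (\<Delta> k + z k + b / a * q)\<^sup>2" by (simp add: power_mult_distrib)
      then have "2 * \<Delta> (Suc k) \<le> \<Delta> k + z k + b / a * q"
        using q z(1)[of k] \<Delta>_nonneg a b by (intro power2_le_imp_le[of "2 * \<Delta> (Suc k)"]) auto
      then show ?thesis by (simp add: q_def P_def algebra_simps)
    qed
    have FS: "(\<lambda>k. F (Suc k)) \<longlonglongrightarrow> c" using F by (rule LIMSEQ_Suc)
    have "(\<lambda>k. F k - F (Suc k)) \<longlonglongrightarrow> 0" using tendsto_diff[OF F FS] by simp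
    then have "(\<lambda>k. sqrt ((F k - F (Suc k)) / a)) \<longlonglongrightarrow> sqrt (0 / a)"
      by (intro tendsto_intros) (use a in auto)
    moreover have "\<Delta> k \<le> sqrt ((F k - F (Suc k)) / a)" for k
      using descent'[of k] a by (intro real_le_rsqrt) (simp add: field_simps)
    ultimately have "\<Delta> \<longlonglongrightarrow> 0"
      using \<Delta>_nonneg by (intro tendsto_sandwich[OF _ _ tendsto_const, of 0 \<Delta>]) auto
    \<comment> \<open>Budget for the radius \<open>\<rho>\<close>: two tenths for
      \<open>2 * \<Delta> m\<close>, one each for the errors, for \<open>P\<close> and for the
      distance of \<open>x m\<close> to \<open>xbar\<close>, and one half for the distance from
      \<open>x\<close> to \<open>yt\<close>.\<close>
    then have ev1: "\<forall>\<^sub>F k in sequentially. \<Delta> k < \<rho> / 10"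
      by (rule order_tendstoD) (use \<rho> in simp)
    have "filterlim (\<lambda>k. F k - c) (at_right 0) sequentially"
      using tendsto_diff[OF F tendsto_const[of c]] F_gt
      by (auto simp: filterlim_at intro!: always_eventually)
    then have "(\<lambda>k. \<phi> (F k - c)) \<longlonglongrightarrow> 0" by (rule filterlim_compose[OF \<phi>_lim])
    then have "P \<longlonglongrightarrow> 0" unfolding P_def by (rule tendsto_mult_right_zero)
    then have ev2: "\<forall>\<^sub>F k in sequentially. P (Suc k) < \<rho> / 10"
      by (intro order_tendstoD(2)[OF LIMSEQ_Suc]) (use \<rho> in auto)
    have ev3: "\<forall>\<^sub>F k in sequentially. G k < c + e"
      by (rule order_tendstoD(2)[OF G(3)]) (use e in simp)
    have ev4: "\<forall>\<^sub>F k in sequentially. dist (yt k - x k) 0 < \<rho> / 2"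
      by (rule tendstoD[OF yt]) (use \<rho> in simp)
    have ev5: "\<forall>\<^sub>F k in sequentially. (\<Sum>j. z (j + k)) < \<rho> / 10"
      by (rule order_tendstoD(2)[OF suminf_exist_split2[OF z(2)]]) (use \<rho> in simp)
    from ev1 ev2 ev3 ev4 ev5 have "\<forall>\<^sub>F k in sequentially. \<Delta> k < \<rho> / 10 \<and> P (Suc k) < \<rho> / 10
        \<and> G k < c + e \<and> dist (yt k - x k) 0 < \<rho> / 2 \<and> (\<Sum>j. z (j + k)) < \<rho> / 10"
      by eventually_elim simp
    then obtain N where N: "\<And>k. k \<ge> N \<Longrightarrow> \<Delta> k < \<rho> / 10" "\<And>k. k \<ge> N \<Longrightarrow> P (Suc k) < \<rho> / 10"
        "\<And>k. k \<ge> N \<Longrightarrow> G k < c + e" "\<And>k. k \<ge> N \<Longrightarrow> dist (yt k - x k) 0 < \<rho> / 2"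
        "\<And>k. k \<ge> N \<Longrightarrow> (\<Sum>j. z (j + k)) < \<rho> / 10"
      unfolding eventually_sequentially by blast
    have "\<forall>\<^sub>F j in sequentially. dist ((x \<circ> r) j) xbar < \<rho> / 10 \<and> N \<le> j"
      using tendstoD[OF r(2), of "\<rho> / 10"] eventually_ge_at_top[of N] \<rho> by (auto intro: eventually_conj)
    then have "\<exists>j. dist ((x \<circ> r) j) xbar < \<rho> / 10 \<and> N \<le> j"
      by (rule eventually_happens'[OF sequentially_bot])
    then obtain j where j: "dist (x (r j)) xbar < \<rho> / 10" "N \<le> j" by auto
    define m where "m = r j"
    have m: "N \<le> m" "dist (x m) xbar < \<rho> / 10"
      using j seq_suble[OF r(1), of j] by (auto simp: m_def)
    have P_nonneg: "0 \<le> P (Suc k)" if "k \<ge> N" for k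
      using N(3)[OF that] G(2)[of k] F_gt[of "Suc k"] \<phi>_nonneg[of "F (Suc k) - c"] a b by (simp add: P_def)
    have z_sum: "(\<Sum>k<n. z (m + k)) < \<rho> / 10" for n
    proof -
      have "(\<Sum>k<n. z (k + m)) \<le> (\<Sum>k. z (k + m))"
        by (rule sum_le_suminf) (use z in \<open>auto simp: summable_iff_shift\<close>)
      then show ?thesis using N(5)[OF m(1)] by (simp add: add.commute)
    qed
    have x_dist: "dist (x (m + n)) (x m) \<le> (\<Sum>k<n. \<Delta> (m + k))" for n
    proof (induction n)
      case (Suc n)
      have "dist (x (m + Suc n)) (x m) \<le> dist (x (m + Suc n)) (x (m + n)) + dist (x (m + n)) (x m)"
        by (rule dist_triangle)
      then show ?case using Suc by (simp add: \<Delta>_def dist_norm)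
    qed simp
    \<comment> \<open>Stated conditionally because the induction for \<open>main\<close> already
      needs it at the preceding index.\<close>
    have sum_bound: "(\<Sum>k<Suc n. \<Delta> (m + k)) \<le> 4 * \<rho> / 10"
      if "(\<Sum>k<Suc n. \<Delta> (m + k)) + \<Delta> (m + n)
        \<le> 2 * \<Delta> m + (\<Sum>k<n. z (m + k)) + (P (Suc m) - P (Suc (m + n)))" for n
      using that z_sum[of n] N(1,2)[OF m(1)] P_nonneg[of "m + n"] m(1) \<Delta>_nonneg[of "m + n"] by linarith
    \<comment> \<open>Bound and location are proved together: the bound at \<open>n\<close> keeps
      \<open>yt (m + n)\<close> in the ball, which permits \<open>rec\<close> at
      \<open>m + n\<close>. The extra \<open>\<Delta> (m + n)\<close> on the left absorbs the
      \<open>\<Delta>\<close> on the right of \<open>rec\<close>.\<close>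
    have main: "(\<Sum>k<Suc n. \<Delta> (m + k)) + \<Delta> (m + n)
        \<le> 2 * \<Delta> m + (\<Sum>k<n. z (m + k)) + (P (Suc m) - P (Suc (m + n)))" for n
    proof (induction n)
      case (Suc n)
      have "dist (yt (m + n)) xbar < \<rho>"
      proof -
        have "(\<Sum>k<n. \<Delta> (m + k)) \<le> 4 * \<rho> / 10"
          using sum_bound[OF Suc] \<Delta>_nonneg[of "m + n"] by simp
        then have "dist (x (m + n)) xbar < \<rho> / 2"
          using x_dist[of n] m(2) dist_triangle[of "x (m + n)" xbar "x m"] by linarith
        moreover have "dist (yt (m + n)) (x (m + n)) < \<rho> / 2"
          using N(4)[of "m + n"] m(1) by (simp add: dist_norm)
        ultimately show ?thesis using dist_triangle[of "yt (m + n)" xbar "x (m + n)"] by linarith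
      qed
      moreover have "G (m + n) - c < e" using N(3)[of "m + n"] m(1) by simp
      ultimately show ?case using rec[of "m + n"] Suc by simp
    qed simp
    have "summable (\<lambda>k. \<Delta> (k + m))"
    proof (rule bounded_imp_summable)
      show "(\<Sum>k\<le>n. \<Delta> (k + m)) \<le> 4 * \<rho> / 10" for n
        using sum_bound[OF main, of n] by (simp add: add.commute lessThan_Suc_atMost)
    qed (rule \<Delta>_nonneg)
    then show ?thesis by (simp add: summable_iff_shift)
  qed
  then show ?thesis by (simp add: \<Delta>_def[abs_def])
qed

section \<open>Convergence of the whole sequence\<close>

lemma summable_norm_diff_imp_convergent:
  fixes x :: "nat \<Rightarrow> 'a::banach"
  assumes "summable (\<lambda>k. norm (x (Suc k) - x k))"
  shows "convergent x"
proof -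
  have "(\<lambda>n. \<Sum>k<n. x (Suc k) - x k) \<longlonglongrightarrow> (\<Sum>k. x (Suc k) - x k)"
    using summable_norm_cancel[OF assms] by (rule summable_LIMSEQ)
  then have "(\<lambda>n. x n - x 0) \<longlonglongrightarrow> (\<Sum>k. x (Suc k) - x k)"
    by (simp add: sum_lessThan_telescope)
  from tendsto_add[OF this tendsto_const[of "x 0"]] show ?thesis by (auto simp: convergent_def)
qed

theorem theorem1:
  fixes f0 :: "real ^ 'n \<Rightarrow> real" and f1 f :: "real ^ 'n \<Rightarrow> ereal"
    and \<Omega>0 :: "(real ^ 'n) set"
    and L \<alpha>min \<alpha>max \<mu> \<delta> \<beta> \<gamma> \<tau> b :: real
    and x yt v :: "nat \<Rightarrow> real ^ 'n" and \<zeta> :: "nat \<Rightarrow> real" and xbar :: "real ^ 'n"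
  assumes f1: "proper_fun f1" "convex_fun f1" "lsc_fun f1"
    and f0_C1: "open \<Omega>0" "effdom f1 \<subseteq> \<Omega>0" "C1_fun_on \<Omega>0 f0"
    and grad_lipschitz: "L > 0"
      "\<And>y z. y \<in> effdom f1 \<Longrightarrow> z \<in> effdom f1 \<Longrightarrow>
         norm (grad f0 y - grad f0 z) \<le> L * norm (y - z)"
    and f_def: "\<And>z. f z = ereal (f0 z) + f1 z"
    and f_bounded_below: "\<exists>m::real. \<forall>z. ereal m \<le> f z"
    and KL: "KL_function f"
    and algorithm: "VMILAn_sequences f0 f1 \<alpha>min \<alpha>max \<mu> \<delta> \<beta> \<gamma> \<tau> x yt"
    and b_pos: "b > 0"
    and zeta_nonneg: "\<And>k. k \<ge> 1 \<Longrightarrow> \<zeta> k \<ge> 0"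
    and zeta_summable: "summable (\<lambda>k. \<zeta> (Suc k))"
    and v_subdiff: "\<And>k. v k \<in> subdiff f (yt k)"
    and v_bound: "\<And>k. norm (v k) \<le> b * norm (x (Suc k) - x k) + \<zeta> (Suc k)"
    and limit_point: "\<exists>r::nat \<Rightarrow> nat. strict_mono r \<and> (x \<circ> r) \<longlonglongrightarrow> xbar"
  shows "summable (\<lambda>k. norm (x (Suc k) - x k)) \<and> x \<longlonglongrightarrow> xbar \<and> stationary_point f xbar"
proof -
  let ?C = "effdom f1"
  define F1 where "F1 z = real_of_ereal (f1 z)" for z
  define F where "F z = f0 z + F1 z" for z
  define K where "K = 4 * \<alpha>max * \<mu> * (1 + \<tau>)"
  define \<sigma> where "\<sigma> = \<beta> * min 1 (2 * \<delta> * (1 - \<beta>) / (L * K))"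
  have pars: "0 < \<alpha>min" "\<alpha>min \<le> \<alpha>max" "1 \<le> \<mu>" "\<delta> \<in> {0<..<1}" "\<beta> \<in> {0<..<1}"
      "\<gamma> \<in> {0..1}" "0 < \<tau>" and x0: "x 0 \<in> ?C"
    and step: "VMILAn_step f0 f1 \<alpha>min \<alpha>max \<mu> \<delta> \<beta> \<gamma> \<tau> (x k) (yt k) (x (Suc k))" for k
    using algorithm unfolding VMILAn_sequences_def by blast+
  have K: "K > 0" using pars unfolding K_def by (intro mult_pos_pos) auto
  have \<sigma>: "\<sigma> > 0" using pars K grad_lipschitz(1) by (simp add: \<sigma>_def)
  have f_proper: "proper_fun f" and f_lsc: "lsc_fun f"
    and f_KL: "\<And>z. z \<in> dom_subdiff f \<Longrightarrow> KL_property_at f z"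
    using KL by (auto simp: KL_function_def)
  have dom_eq: "effdom f = ?C" by (auto simp: effdom_def f_def)
  have f_real: "f z = ereal (F z)" if "z \<in> ?C" for z
    unfolding f_def F_def F1_def by (subst proper_fun_ereal_real[OF f1(1) that]) simp
  have diff: "f0 differentiable (at z)" if "z \<in> ?C" for z
    using f0_C1 that by (auto simp: C1_fun_on_def)
  have yt_dom: "yt k \<in> ?C" for k using v_subdiff[of k] by (simp add: subdiff_def dom_eq)

  \<comment> \<open>Bundling the estimates in one predicate lets a single sequence
    \<open>\<eta>\<close> be chosen. Membership of \<open>x (Suc k)\<close> is included because the
    estimates presuppose \<open>x k\<close> in the domain, which is proved by induction.\<close>
  define Q where "Q k \<eta> \<longleftrightarrow> 0 \<le> \<eta> \<and> (norm (yt k - x k))\<^sup>2 \<le> K * \<eta> \<and> x (Suc k) \<in> ?C \<and>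
      F (x (Suc k)) \<le> F (x k) - \<sigma> * \<eta> \<and> F (x (Suc k)) \<le> F (yt k) \<and>
      F (yt k) \<le> F (x k) + L / 2 * K * \<eta> \<and> norm (x (Suc k) - x k) \<le> norm (yt k - x k) \<and>
      (\<forall>z\<in>?C. F1 (yt k) \<le> F1 z + grad f0 (x k) \<bullet> (z - yt k)
        + \<mu> / (2 * \<alpha>min) * (norm (z - x k))\<^sup>2 + \<tau> / 2 * \<eta>)" for k \<eta>
  have ex_Q: "\<exists>\<eta>. Q k \<eta>" if xk: "x k \<in> ?C" for k
    by (rule VMILAn_step_estimates[OF f1(1,2) diff grad_lipschitz pars step[of k] xk yt_dom[of k]])
      (auto simp: Q_def F_def F1_def K_def \<sigma>_def)
  have x_dom: "x k \<in> ?C" for k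
  proof (induction k)
    case (Suc k)
    then show ?case using ex_Q[of k] by (auto simp: Q_def)
  qed (rule x0)
  obtain \<eta> where "\<And>k. Q k (\<eta> k)" using ex_Q[OF x_dom] by metis
  then have \<eta>_nonneg: "0 \<le> \<eta> k" and yt_x: "(norm (yt k - x k))\<^sup>2 \<le> K * \<eta> k"
    and F_descent: "F (x (Suc k)) \<le> F (x k) - \<sigma> * \<eta> k" and F_yt_ge: "F (x (Suc k)) \<le> F (yt k)"
    and F_yt_le: "F (yt k) \<le> F (x k) + L / 2 * K * \<eta> k"
    and step_le: "norm (x (Suc k) - x k) \<le> norm (yt k - x k)"
    and F1_yt_le: "z \<in> ?C \<Longrightarrow> F1 (yt k) \<le> F1 z + grad f0 (x k) \<bullet> (z - yt k)
        + \<mu> / (2 * \<alpha>min) * (norm (z - x k))\<^sup>2 + \<tau> / 2 * \<eta> k" for k z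
    unfolding Q_def by blast+

  have descent: "F (x (Suc k)) \<le> F (x k) - \<sigma> / K * (norm (x (Suc k) - x k))\<^sup>2" for k
  proof -
    have "(norm (x (Suc k) - x k))\<^sup>2 \<le> K * \<eta> k"
      using power_mono[OF step_le norm_ge_zero] yt_x by (rule order_trans)
    then have "\<sigma> / K * (norm (x (Suc k) - x k))\<^sup>2 \<le> \<sigma> / K * (K * \<eta> k)"
      using \<sigma> K by (intro mult_left_mono) auto
    then show ?thesis using F_descent[of k] K by simp
  qed
  obtain m where m: "\<And>z. ereal m \<le> f z" using f_bounded_below by blast
  have "decseq (\<lambda>k. F (x k))"
  proof (rule decseq_SucI)
    show "F (x (Suc k)) \<le> F (x k)" for k
      using F_descent[of k] mult_nonneg_nonneg[of \<sigma> "\<eta> k"] \<sigma> \<eta>_nonneg[of k] by linarith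
  qed
  moreover have "\<forall>k. m \<le> F (x k)" using m f_real[OF x_dom] by (metis ereal_less_eq(3))
  ultimately obtain c where Fc: "(\<lambda>k. F (x k)) \<longlonglongrightarrow> c" by (rule decseq_convergent)
  have FSc: "(\<lambda>k. F (x (Suc k))) \<longlonglongrightarrow> c" using Fc by (rule LIMSEQ_Suc)
  have "(\<lambda>k. (F (x k) - F (x (Suc k))) / \<sigma>) \<longlonglongrightarrow> (c - c) / \<sigma>"
    by (intro tendsto_intros Fc FSc) (use \<sigma> in auto)
  moreover have "\<eta> k \<le> (F (x k) - F (x (Suc k))) / \<sigma>" for k
    using F_descent[of k] \<sigma> by (simp add: field_simps)
  ultimately have \<eta>0: "\<eta> \<longlonglongrightarrow> 0"
    using \<eta>_nonneg by (intro tendsto_sandwich[OF _ _ tendsto_const, of 0 \<eta>]) auto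
  \<comment> \<open>The trial values are squeezed between \<open>F (x (Suc k))\<close> and
    \<open>F (x k)\<close> plus a multiple of \<open>\<eta> k\<close>.\<close>
  have Gc: "(\<lambda>k. F (yt k)) \<longlonglongrightarrow> c"
  proof (rule tendsto_sandwich[OF _ _ FSc])
    show "(\<lambda>k. F (x k) + L / 2 * K * \<eta> k) \<longlonglongrightarrow> c"
      using tendsto_add[OF Fc tendsto_mult_right_zero[OF \<eta>0, of "L / 2 * K"]] by simp
  qed (use F_yt_ge F_yt_le in auto)
  have "(\<lambda>k. sqrt (K * \<eta> k)) \<longlonglongrightarrow> sqrt (K * 0)" by (intro tendsto_intros \<eta>0)
  moreover have "norm (yt k - x k) \<le> sqrt (K * \<eta> k)" for k using yt_x by (rule real_le_rsqrt)
  ultimately have "(\<lambda>k. norm (yt k - x k)) \<longlonglongrightarrow> 0"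
    by (intro tendsto_sandwich[OF _ _ tendsto_const, of 0 "\<lambda>k. norm (yt k - x k)"]) auto
  then have d0: "(\<lambda>k. yt k - x k) \<longlonglongrightarrow> 0" by (rule tendsto_norm_zero_cancel)
  have \<Delta>0: "(\<lambda>k. norm (x (Suc k) - x k)) \<longlonglongrightarrow> 0"
    using \<open>(\<lambda>k. norm (yt k - x k)) \<longlonglongrightarrow> 0\<close> step_le
    by (intro tendsto_sandwich[OF _ _ tendsto_const, of 0 "\<lambda>k. norm (x (Suc k) - x k)"]) auto
  have v0: "v \<longlonglongrightarrow> 0"
  proof (rule Lim_null_comparison)
    show "(\<lambda>k. b * norm (x (Suc k) - x k) + \<zeta> (Suc k)) \<longlonglongrightarrow> 0"
      using tendsto_add[OF tendsto_mult_right_zero[OF \<Delta>0, of b]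
        summable_LIMSEQ_zero[OF zeta_summable]] by simp
  qed (use v_bound in auto)

  obtain r where r: "strict_mono r" "(x \<circ> r) \<longlonglongrightarrow> xbar" using limit_point by blast
  have xr: "(\<lambda>j. x (r j)) \<longlonglongrightarrow> xbar" using r(2) by (simp add: o_def)
  note sub = LIMSEQ_subseq_LIMSEQ[OF _ r(1), unfolded o_def]
  have ytr: "(\<lambda>j. yt (r j)) \<longlonglongrightarrow> xbar" using tendsto_add[OF xr sub[OF d0]] by simp
  have "(\<lambda>j. f (yt (r j))) \<longlonglongrightarrow> ereal c" using sub[OF Gc] by (simp add: f_real[OF yt_dom])
  \<comment> \<open>Besides one half of \<open>f xbar = c\<close>, this puts \<open>xbar\<close> in
    the domain, so that it can serve as a comparison point in \<open>F1_yt_le\<close>.\<close>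
  then have f_le: "f xbar \<le> ereal c" by (rule lsc_fun_le_limit[OF f_lsc ytr])
  then have "f xbar < \<infinity>" by (rule le_less_trans) simp
  then have "xbar \<in> effdom f" by (simp add: effdom_def)
  then have xbar: "xbar \<in> ?C" by (simp only: dom_eq)
  \<comment> \<open>Lower semicontinuity does not give this direction. Near-minimality of
    \<open>yt (r j)\<close> in the model, compared with \<open>xbar\<close>, does: the linear,
    quadratic and inexactness terms all vanish in the limit.\<close>
  have "c \<le> F xbar"
  proof (rule LIMSEQ_le[OF sub[OF Gc]])
    have "(\<lambda>j. L * norm (x (r j) - xbar)) \<longlonglongrightarrow> 0"
      by (intro tendsto_mult_right_zero tendsto_norm_zero) (use xr LIM_zero in auto)
    then have grad_lim: "(\<lambda>j. grad f0 (x (r j))) \<longlonglongrightarrow> grad f0 xbar"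
      by (rule LIMSEQ_dist_le_transform[OF tendsto_const]) (simp add: dist_norm grad_lipschitz(2) x_dom xbar)
    have "isCont f0 xbar" using diff[OF xbar] by (rule differentiable_imp_continuous_within)
    then have f0_lim: "(\<lambda>j. f0 (yt (r j))) \<longlonglongrightarrow> f0 xbar" using ytr by (rule isCont_tendsto_compose)
    have "(\<lambda>j. f0 (yt (r j)) + (F1 xbar + grad f0 (x (r j)) \<bullet> (xbar - yt (r j))
        + \<mu> / (2 * \<alpha>min) * (norm (xbar - x (r j)))\<^sup>2 + \<tau> / 2 * \<eta> (r j)))
      \<longlonglongrightarrow> f0 xbar + (F1 xbar + grad f0 xbar \<bullet> (xbar - xbar)
        + \<mu> / (2 * \<alpha>min) * (norm (xbar - xbar))\<^sup>2 + \<tau> / 2 * 0)"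
      by (intro tendsto_add tendsto_inner tendsto_diff tendsto_mult tendsto_power tendsto_norm
          tendsto_const f0_lim grad_lim ytr xr sub[OF \<eta>0])
    then show "(\<lambda>j. f0 (yt (r j)) + (F1 xbar + grad f0 (x (r j)) \<bullet> (xbar - yt (r j))
        + \<mu> / (2 * \<alpha>min) * (norm (xbar - x (r j)))\<^sup>2 + \<tau> / 2 * \<eta> (r j))) \<longlonglongrightarrow> F xbar"
      by (simp add: F_def)
  qed (use F1_yt_le[OF xbar] in \<open>auto simp: F_def\<close>)
  then have f_xbar: "f xbar = ereal c" using f_le f_real[OF xbar] by simp
  \<comment> \<open>Stationarity is obtained before summability: it places \<open>xbar\<close> in
    \<open>dom_subdiff f\<close>, where the Kurdyka-Lojasiewicz property is available.\<close>
  have "0 \<in> subdiff f xbar"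
  proof (rule subdiff_closed[OF f_proper _ ytr])
    show "xbar \<in> effdom f" using xbar by (simp add: dom_eq)
    show "(\<lambda>j. f (yt (r j))) \<longlonglongrightarrow> f xbar"
      using sub[OF Gc] by (simp add: f_real[OF yt_dom] f_xbar)
    show "v (r j) \<in> subdiff f (yt (r j))" for j by (rule v_subdiff)
  qed (rule sub[OF v0])
  then have stat: "stationary_point f xbar" and "xbar \<in> dom_subdiff f"
    using xbar by (auto simp: stationary_point_def dom_subdiff_def dom_eq)
  have summable: "summable (\<lambda>k. norm (x (Suc k) - x k))"
  proof (rule KL_finite_length[OF f_proper f_KL[OF \<open>xbar \<in> dom_subdiff f\<close>] f_xbar _ b_pos
        descent Fc f_real[OF yt_dom] F_yt_ge Gc d0 v_subdiff _ _ _ r])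
    show "0 < \<sigma> / K" using \<sigma> K by simp
    show "norm (v k) \<le> b * (norm (x (Suc k) - x k) + \<zeta> (Suc k) / b)" for k
      using v_bound[of k] b_pos by (simp add: distrib_left)
    show "0 \<le> \<zeta> (Suc k) / b" for k using zeta_nonneg[of "Suc k"] b_pos by simp
    show "summable (\<lambda>k. \<zeta> (Suc k) / b)" using zeta_summable by (rule summable_divide)
  qed
  obtain l where l: "x \<longlonglongrightarrow> l"
    using summable_norm_diff_imp_convergent[OF summable] by (auto simp: convergent_def)
  \<comment> \<open>The limit of the whole sequence is identified through the subsequence converging
    to \<open>xbar\<close>.\<close>
  have "l = xbar" using sub[OF l] xr by (rule LIMSEQ_unique)
  then show ?thesis using summable l stat by simp
qed

end
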